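(* Let $\{X(t),t\ge0\}$ be an $H$-sssi stochastic process with all positive order moments finite, i.e. $E|X(t)|^q<\infty$ for every $q>0$ and $t\geq 0$. Suppose that for every $\alpha<0$ there is $m_0\in\mathbb{N}$ such that $$E\Big[\max_{l=1,\dots,m_0}|X(l)-X(l-1)|\Big]^{\alpha}<\infty .$$ Then $\{X(t)\}$ has a trivial spectrum: for every $T>0$, almost every sample path on $[0,T]$ satisfies $d(h)=-\infty$ for all $h\neq H$.
   Context: All processes are real-valued, measurable, separable, not a.s. constant, and stochastically continuous at zero, i.e. $P(|X(h)|>\varepsilon)\to0$ as $h\to0$ for every $\varepsilon>0$. A process is $H$-sssi ($H\ge0$) if it is $H$-self-similar, i.e. for every $a>0$ the processes $\{X(at)\}$ and $\{a^HX(t)\}$ have the same finite dimensional distributions, and has stationary increments, i.e. for every $s\ge0$ the processes $\{X(s+t)-X(s)\}_{t\ge0}$ and $\{X(t)-X(0)\}_{t\ge0}$ have the same finite dimensional distributions. Pointwise Hölder exponent: $f\in C^{\gamma}(t_0)$ if there is $C>0$ such that $|f(t)-f(t_0)|\le C|t-t_0|^{\gamma}$ for all $t$ (in the domain of $f$) in some neighbourhood of $t_0$; $H(t_0)=\sup\{\gamma\ge 0: f\in C^{\gamma}(t_0)\}$ with $\sup\emptyset=0$. The spectrum $d(h)$ of a path on $[0,T]$ is the Hausdorff dimension of $S_h=\{t\in[0,T]:H(t)=h\}$, with $\dim_H\emptyset=-\infty$. Convention on modifications: since $E|X(T)|^q<\infty$ for all $q>0$, if $H>0$ the Kolmogorov–Chentsov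 theorem gives a modification of $\{X(t),t\in[0,T]\}$ that is a.s. locally Hölder continuous with every exponent $\gamma\in(0,H)$; $X$ denotes this modification. For $\alpha<0$, $0^\alpha=+\infty$. *)

theory Defs
  imports "HOL-Probability.Probability"
begin

text \<open>
  A process with time set \<open>[0, \<infinity>)\<close> is a function \<open>X :: real \<Rightarrow> 'a \<Rightarrow> real\<close>; its values at negative
  times are irrelevant and no definition below refers to them.
\<close>

definition measurable_process :: "'a measure \<Rightarrow> (real \<Rightarrow> 'a \<Rightarrow> real) \<Rightarrow> bool" where
  "measurable_process M X \<longleftrightarrow>
     (\<lambda>(t, \<omega>). X t \<omega>) \<in> borel_measurable (restrict_space borel {0..} \<Otimes>\<^sub>M M)"

text \<open>
  Separability in the sense of Doob, relative to the class of closed sets: one countable set of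
  times and one exceptional null set serve all open intervals and all closed sets.
\<close>

definition separable_process :: "'a measure \<Rightarrow> (real \<Rightarrow> 'a \<Rightarrow> real) \<Rightarrow> bool" where
  "separable_process M X \<longleftrightarrow>
     (\<exists>D. countable D \<and> D \<subseteq> {0..} \<and>
       (AE \<omega> in M. \<forall>a b F. closed F \<longrightarrow>
          (\<forall>t\<in>{a<..<b} \<inter> D. X t \<omega> \<in> F) \<longrightarrow> (\<forall>t\<in>{a<..<b} \<inter> {0..}. X t \<omega> \<in> F)))"

definition as_constant :: "'a measure \<Rightarrow> (real \<Rightarrow> 'a \<Rightarrow> real) \<Rightarrow> bool" where
  "as_constant M X \<longleftrightarrow> (\<exists>c. AE \<omega> in M. \<forall>t\<ge>0. X t \<omega> = c)"

definition stoch_continuous_at_zero :: "'a measure \<Rightarrow> (real \<Rightarrow> 'a \<Rightarrow> real) \<Rightarrow> bool" where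
  "stoch_continuous_at_zero M X \<longleftrightarrow>
     (\<forall>\<epsilon>>0. ((\<lambda>h. measure M {\<omega>\<in>space M. \<bar>X h \<omega>\<bar> > \<epsilon>}) \<longlongrightarrow> 0) (at_right 0))"

definition same_fdd :: "'a measure \<Rightarrow> (real \<Rightarrow> 'a \<Rightarrow> real) \<Rightarrow> (real \<Rightarrow> 'a \<Rightarrow> real) \<Rightarrow> bool" where
  "same_fdd M X Y \<longleftrightarrow>
     (\<forall>J. finite J \<and> J \<subseteq> {0..} \<longrightarrow>
        distr M (\<Pi>\<^sub>M t\<in>J. borel) (\<lambda>\<omega>. \<lambda>t\<in>J. X t \<omega>) =
        distr M (\<Pi>\<^sub>M t\<in>J. borel) (\<lambda>\<omega>. \<lambda>t\<in>J. Y t \<omega>))"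

definition self_similar :: "'a measure \<Rightarrow> real \<Rightarrow> (real \<Rightarrow> 'a \<Rightarrow> real) \<Rightarrow> bool" where
  "self_similar M H X \<longleftrightarrow>
     (\<forall>a>0. same_fdd M (\<lambda>t. X (a * t)) (\<lambda>t \<omega>. a powr H * X t \<omega>))"

definition stationary_increments :: "'a measure \<Rightarrow> (real \<Rightarrow> 'a \<Rightarrow> real) \<Rightarrow> bool" where
  "stationary_increments M X \<longleftrightarrow>
     (\<forall>s\<ge>0. same_fdd M (\<lambda>t \<omega>. X (s + t) \<omega> - X s \<omega>) (\<lambda>t \<omega>. X t \<omega> - X 0 \<omega>))"

definition sssi :: "'a measure \<Rightarrow> real \<Rightarrow> (real \<Rightarrow> 'a \<Rightarrow> real) \<Rightarrow> bool" where
  "sssi M H X \<longleftrightarrow> H \<ge> 0 \<and> self_similar M H X \<and> stationary_increments M X"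

text \<open>
  Powers of nonnegative reals with the convention \<open>0\<^sup>\<alpha> = \<infinity>\<close> for \<open>\<alpha> < 0\<close>
  (whereas \<open>0 powr \<alpha> = 0\<close>).
\<close>

definition ext_powr :: "real \<Rightarrow> real \<Rightarrow> ennreal" where
  "ext_powr x \<alpha> = (if x = 0 \<and> \<alpha> < 0 then \<infinity> else ennreal (x powr \<alpha>))"

definition locally_Holder_on :: "real set \<Rightarrow> real \<Rightarrow> (real \<Rightarrow> real) \<Rightarrow> bool" where
  "locally_Holder_on D \<gamma> f \<longleftrightarrow>
     (\<forall>t0\<in>D. \<exists>U C. open U \<and> t0 \<in> U \<and> C > 0 \<and>
        (\<forall>s\<in>U \<inter> D. \<forall>t\<in>U \<inter> D. \<bar>f s - f t\<bar> \<le> C * \<bar>s - t\<bar> powr \<gamma>))"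

definition modification_on ::
  "'a measure \<Rightarrow> real set \<Rightarrow> (real \<Rightarrow> 'a \<Rightarrow> real) \<Rightarrow> (real \<Rightarrow> 'a \<Rightarrow> real) \<Rightarrow> bool" where
  "modification_on M D X Y \<longleftrightarrow>
     (\<forall>t\<in>D. Y t \<in> borel_measurable M \<and> (AE \<omega> in M. Y t \<omega> = X t \<omega>))"

text \<open>
  The modifications of \<open>X\<close> on \<open>[0, T]\<close> provided by the Kolmogorov--Chentsov theorem; any two of
  them are indistinguishable if \<open>H > 0\<close>.
\<close>

definition Holder_modification ::
  "'a measure \<Rightarrow> real \<Rightarrow> real \<Rightarrow> (real \<Rightarrow> 'a \<Rightarrow> real) \<Rightarrow> (real \<Rightarrow> 'a \<Rightarrow> real) \<Rightarrow> bool" where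
  "Holder_modification M H T X Y \<longleftrightarrow>
     modification_on M {0..T} X Y \<and>
     (AE \<omega> in M. \<forall>\<gamma>\<in>{0<..<H}. locally_Holder_on {0..T} \<gamma> (\<lambda>t. Y t \<omega>))"

text \<open>The class \<open>C\<^sup>\<gamma>(t0)\<close> for a function with domain \<open>D\<close>; the bound is trivial at \<open>t = t0\<close>.\<close>

definition Holder_at :: "real set \<Rightarrow> real \<Rightarrow> real \<Rightarrow> (real \<Rightarrow> real) \<Rightarrow> bool" where
  "Holder_at D t0 \<gamma> f \<longleftrightarrow>
     (\<exists>C>0. \<forall>\<^sub>F t in at t0 within D. \<bar>f t - f t0\<bar> \<le> C * \<bar>t - t0\<bar> powr \<gamma>)"

text \<open>The supremum is taken in \<^typ>\<open>ennreal\<close>, where the empty set has supremum 0.\<close>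

definition Holder_exponent :: "real set \<Rightarrow> (real \<Rightarrow> real) \<Rightarrow> real \<Rightarrow> ennreal" where
  "Holder_exponent D f t0 = Sup {ennreal \<gamma> | \<gamma>. \<gamma> \<ge> 0 \<and> Holder_at D t0 \<gamma> f}"

definition Hausdorff_premeasure :: "real \<Rightarrow> real \<Rightarrow> 'a::metric_space set \<Rightarrow> ennreal" where
  "Hausdorff_premeasure s \<delta> S =
     (INF A \<in> {A :: nat \<Rightarrow> 'a set. S \<subseteq> (\<Union>i. A i) \<and> (\<forall>i. bounded (A i) \<and> diameter (A i) \<le> \<delta>)}.
        \<Sum>i. ennreal (diameter (A i) powr s))"

definition Hausdorff_measure :: "real \<Rightarrow> 'a::metric_space set \<Rightarrow> ennreal" where
  "Hausdorff_measure s S = (SUP \<delta>\<in>{0<..}. Hausdorff_premeasure s \<delta> S)"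

text \<open>
  Only \<open>s > 0\<close> is used: this does not change the infimum and avoids the case \<open>0 powr 0 = 0\<close>, for
  which the formula above would not give the counting measure.
\<close>

definition Hausdorff_dim :: "'a::metric_space set \<Rightarrow> ereal" where
  "Hausdorff_dim S =
     (if S = {} then -\<infinity> else Inf {ereal s | s. s > 0 \<and> Hausdorff_measure s S = 0})"

definition spectrum_on :: "real \<Rightarrow> (real \<Rightarrow> real) \<Rightarrow> ennreal \<Rightarrow> ereal" where
  "spectrum_on T f h = Hausdorff_dim {t\<in>{0..T}. Holder_exponent {0..T} f t = h}"

definition trivial_spectrum_on :: "real \<Rightarrow> real \<Rightarrow> (real \<Rightarrow> real) \<Rightarrow> bool" where
  "trivial_spectrum_on H T f \<longleftrightarrow> (\<forall>h. h \<noteq> ennreal H \<longrightarrow> spectrum_on T f h = -\<infinity>)"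

end

theory Submission
  imports Defs
begin

text \<open>
  If \<open>H = 0\<close>, self-similarity and stochastic continuity at zero force all increments to vanish,
  which contradicts the negative moments; so \<open>H > 0\<close>. The positive moments then give the
  modification and the bound \<open>H(t) \<ge> H\<close> by the Kolmogorov--Chentsov argument on the grid
  \<open>k T / 2\<^sup>n\<close>. For the reverse bound let \<open>\<gamma> > H\<close> and divide \<open>[0, T]\<close> into \<open>2\<^sup>n\<close> blocks, each cut into
  \<open>m\<close> equal steps. By self-similarity and Markov's inequality for the moment of order
  \<open>-2 / (\<gamma> - H)\<close>, the largest increment in a given block is below \<open>c 2\<^bsup>-n\<gamma>\<^esup>\<close> with probability
  \<open>O(4\<^bsup>-n\<^esup>)\<close>. Summed over blocks and levels this is finite, so almost surely, for large \<open>n\<close>, every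
  block contains an increment of size \<open>c 2\<^bsup>-n\<gamma>\<^esup>\<close>; this excludes any exponent above \<open>\<gamma>\<close> at the points
  of all blocks simultaneously.
\<close>

section \<open>Measurability and transfer of laws through finite-dimensional distributions\<close>

lemma process_borel_measurable:
  assumes "measurable_process M X" "t \<ge> 0"
  shows "X t \<in> borel_measurable M"
proof -
  have "(\<lambda>\<omega>. (t, \<omega>)) \<in> measurable M (restrict_space borel {0..} \<Otimes>\<^sub>M M)"
    using assms(2) by (intro measurable_Pair) (auto intro!: measurable_restrict_space2)
  from measurable_compose[OF this assms(1)[unfolded measurable_process_def]]
  show ?thesis by simp
qed

text \<open>Both sides are push-forwards under \<open>f\<close> of the joint law on
  \<open>J\<close>. The restriction to \<open>J\<close> keeps the random vector in the product
  space; later uses remove it again inside \<open>f\<close>.\<close>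

lemma same_fdd_distr:
  assumes "same_fdd M X Y" "finite J" "J \<subseteq> {0..}"
    and X [measurable]: "\<And>t. t \<in> J \<Longrightarrow> X t \<in> borel_measurable M"
    and Y [measurable]: "\<And>t. t \<in> J \<Longrightarrow> Y t \<in> borel_measurable M"
    and f: "f \<in> measurable (\<Pi>\<^sub>M t\<in>J. borel) L"
  shows "distr M L (\<lambda>\<omega>. f (\<lambda>t\<in>J. X t \<omega>)) = distr M L (\<lambda>\<omega>. f (\<lambda>t\<in>J. Y t \<omega>))"
proof -
  have "distr (distr M (\<Pi>\<^sub>M t\<in>J. borel) (\<lambda>\<omega>. \<lambda>t\<in>J. Z t \<omega>)) L f = distr M L (\<lambda>\<omega>. f (\<lambda>t\<in>J. Z t \<omega>))"
    if "\<And>t. t \<in> J \<Longrightarrow> Z t \<in> borel_measurable M" for Z :: "real \<Rightarrow> 'a \<Rightarrow> real"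
    using that by (subst distr_distr[OF f]) (auto simp: o_def intro!: measurable_restrict)
  then show ?thesis
    using assms unfolding same_fdd_def by metis
qed

lemma same_fdd_nn_integral:
  assumes "same_fdd M X Y" "finite J" "J \<subseteq> {0..}"
    and X: "\<And>t. t \<in> J \<Longrightarrow> X t \<in> borel_measurable M"
    and Y: "\<And>t. t \<in> J \<Longrightarrow> Y t \<in> borel_measurable M"
    and g: "g \<in> borel_measurable (\<Pi>\<^sub>M t\<in>J. borel)"
  shows "(\<integral>\<^sup>+\<omega>. g (\<lambda>t\<in>J. X t \<omega>) \<partial>M) = (\<integral>\<^sup>+\<omega>. g (\<lambda>t\<in>J. Y t \<omega>) \<partial>M)"
proof -
  have "(\<integral>\<^sup>+\<omega>. g (\<lambda>t\<in>J. Z t \<omega>) \<partial>M) = (\<integral>\<^sup>+x. x \<partial>distr M borel (\<lambda>\<omega>. g (\<lambda>t\<in>J. Z t \<omega>)))"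
    if "\<And>t. t \<in> J \<Longrightarrow> Z t \<in> borel_measurable M" for Z :: "real \<Rightarrow> 'a \<Rightarrow> real"
    using that
    by (subst nn_integral_distr) (auto intro!: measurable_compose[OF _ g] measurable_restrict)
  then show ?thesis
    using same_fdd_distr[OF assms] X Y by simp
qed

text \<open>Stationarity moves the base point \<open>s\<close> to 0 at the times
  \<open>h * t\<close>; self-similarity then extracts \<open>h powr H\<close>. Joint laws are kept
  throughout, because block maxima depend on several times at once.\<close>

lemma sssi_increments_same_fdd:
  assumes sssi: "sssi M H X" and meas: "\<And>t. t \<ge> 0 \<Longrightarrow> X t \<in> borel_measurable M"
    and "s \<ge> 0" "h > 0"
  shows "same_fdd M (\<lambda>t \<omega>. X (s + h * t) \<omega> - X s \<omega>) (\<lambda>t \<omega>. h powr H * (X t \<omega> - X 0 \<omega>))"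
  unfolding same_fdd_def
proof (intro allI impI, elim conjE)
  fix J :: "real set" assume J: "finite J" "J \<subseteq> {0..}"
  let ?P = "\<Pi>\<^sub>M t\<in>J. (borel :: real measure)"
  let ?K = "(*) h ` J"
  have K: "finite ?K" "?K \<subseteq> {0..}" using J \<open>h > 0\<close> by auto
  have "same_fdd M (\<lambda>t \<omega>. X (s + t) \<omega> - X s \<omega>) (\<lambda>t \<omega>. X t \<omega> - X 0 \<omega>)"
    using sssi \<open>s \<ge> 0\<close> by (auto simp: sssi_def stationary_increments_def)
  then have "distr M ?P (\<lambda>\<omega>. \<lambda>t\<in>J. (\<lambda>t\<in>?K. X (s + t) \<omega> - X s \<omega>) (h * t)) =
        distr M ?P (\<lambda>\<omega>. \<lambda>t\<in>J. (\<lambda>t\<in>?K. X t \<omega> - X 0 \<omega>) (h * t))"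
    using K \<open>s \<ge> 0\<close>
    by (intro same_fdd_distr[OF _ K, where f = "\<lambda>x. \<lambda>t\<in>J. x (h * t)" and L = ?P])
       (auto intro!: measurable_restrict measurable_component_singleton borel_measurable_diff meas)
  moreover have "(\<lambda>t\<in>J. restrict g ?K (h * t)) = (\<lambda>t\<in>J. g (h * t))" for g :: "real \<Rightarrow> real"
    by (auto intro!: restrict_ext)
  ultimately have 1: "distr M ?P (\<lambda>\<omega>. \<lambda>t\<in>J. X (s + h * t) \<omega> - X s \<omega>) =
        distr M ?P (\<lambda>\<omega>. \<lambda>t\<in>J. X (h * t) \<omega> - X 0 \<omega>)"
    by (simp only:)
  \<comment> \<open>Time 0 is adjoined so that \<open>X 0\<close> is scaled jointly with the other
    values; multiplication by \<open>h\<close> fixes it.\<close>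
  let ?L = "insert 0 J"
  have L: "finite ?L" "?L \<subseteq> {0..}" using J by auto
  have scaling: "same_fdd M (\<lambda>t. X (h * t)) (\<lambda>t \<omega>. h powr H * X t \<omega>)"
    using sssi \<open>h > 0\<close> by (auto simp: sssi_def self_similar_def)
  have meas_L: "X (h * t) \<in> borel_measurable M" "(\<lambda>\<omega>. h powr H * X t \<omega>) \<in> borel_measurable M"
    if "t \<in> ?L" for t
  proof -
    have "t \<ge> 0" using that L by auto
    then show "X (h * t) \<in> borel_measurable M" "(\<lambda>\<omega>. h powr H * X t \<omega>) \<in> borel_measurable M"
      using \<open>h > 0\<close> meas[of t] meas[of "h * t"] by auto
  qed
  have "(\<lambda>x. \<lambda>t\<in>J. x t - x 0) \<in> measurable (\<Pi>\<^sub>M t\<in>?L. borel) ?P"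
    by (rule measurable_restrict, rule borel_measurable_diff)
       (rule measurable_component_singleton, simp)+
  from same_fdd_distr[OF scaling L meas_L this]
  have "distr M ?P (\<lambda>\<omega>. \<lambda>t\<in>J. (\<lambda>t\<in>?L. X (h * t) \<omega>) t - (\<lambda>t\<in>?L. X (h * t) \<omega>) 0) =
        distr M ?P (\<lambda>\<omega>. \<lambda>t\<in>J. (\<lambda>t\<in>?L. h powr H * X t \<omega>) t - (\<lambda>t\<in>?L. h powr H * X t \<omega>) 0)" .
  moreover have "(\<lambda>t\<in>J. restrict g ?L t - restrict g ?L 0) = (\<lambda>t\<in>J. g t - g 0)" for g :: "real \<Rightarrow> real"
    by (auto intro!: restrict_ext)
  ultimately have "distr M ?P (\<lambda>\<omega>. \<lambda>t\<in>J. X (h * t) \<omega> - X 0 \<omega>) =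
        distr M ?P (\<lambda>\<omega>. \<lambda>t\<in>J. h powr H * (X t \<omega> - X 0 \<omega>))"
    by (simp only: right_diff_distrib mult_zero_right)
  with 1 show "distr M ?P (\<lambda>\<omega>. \<lambda>t\<in>J. X (s + h * t) \<omega> - X s \<omega>) =
        distr M ?P (\<lambda>\<omega>. \<lambda>t\<in>J. h powr H * (X t \<omega> - X 0 \<omega>))" by simp
qed

text \<open>The one-time marginal at 1 of the joint scaling with step \<open>t - s\<close>.\<close>

lemma sssi_increment_moment:
  assumes sssi: "sssi M H X" and meas: "\<And>t. t \<ge> 0 \<Longrightarrow> X t \<in> borel_measurable M"
    and "0 \<le> s" "s < t"
  shows "(\<integral>\<^sup>+\<omega>. ennreal (\<bar>X t \<omega> - X s \<omega>\<bar> powr q) \<partial>M) =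
         (\<integral>\<^sup>+\<omega>. ennreal (\<bar>X 1 \<omega> - X 0 \<omega>\<bar> powr q) \<partial>M) * ennreal ((t - s) powr (H * q))"
proof -
  have "(\<integral>\<^sup>+\<omega>. ennreal (\<bar>X t \<omega> - X s \<omega>\<bar> powr q) \<partial>M) =
        (\<integral>\<^sup>+\<omega>. ennreal (\<bar>(t - s) powr H * (X 1 \<omega> - X 0 \<omega>)\<bar> powr q) \<partial>M)"
  proof -
    have "same_fdd M (\<lambda>u \<omega>. X (s + (t - s) * u) \<omega> - X s \<omega>)
            (\<lambda>u \<omega>. (t - s) powr H * (X u \<omega> - X 0 \<omega>))"
      using assms by (intro sssi_increments_same_fdd[OF sssi meas]) auto
    from same_fdd_nn_integral[OF this, of "{1}" "\<lambda>x. ennreal (\<bar>x 1\<bar> powr q)"]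
    show ?thesis using assms(3,4) meas by auto
  qed
  also have "\<dots> = (\<integral>\<^sup>+\<omega>. ennreal ((t - s) powr (H * q)) * ennreal (\<bar>X 1 \<omega> - X 0 \<omega>\<bar> powr q) \<partial>M)"
    by (simp add: abs_mult powr_mult powr_powr ennreal_mult)
  finally show ?thesis
    using meas by (simp add: nn_integral_cmult mult.commute)
qed

section \<open>Elementary tools: a moment inequality, summability, telescoping\<close>

text \<open>Bounding the difference by twice the maximum covers all \<open>q > 0\<close>, including
  \<open>q < 1\<close>, where convexity of the power fails.\<close>

lemma powr_abs_diff_le:
  fixes a b q :: real
  assumes "q > 0"
  shows "\<bar>a - b\<bar> powr q \<le> 2 powr q * (\<bar>a\<bar> powr q + \<bar>b\<bar> powr q)"
proof -
  have "\<bar>a - b\<bar> powr q \<le> (2 * max \<bar>a\<bar> \<bar>b\<bar>) powr q"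
    using assms by (intro powr_mono2) auto
  also have "\<dots> = 2 powr q * max \<bar>a\<bar> \<bar>b\<bar> powr q"
    by (simp add: powr_mult)
  also have "max \<bar>a\<bar> \<bar>b\<bar> powr q \<le> \<bar>a\<bar> powr q + \<bar>b\<bar> powr q"
    by (auto simp: max_def)
  finally show ?thesis by simp
qed

text \<open>Borel--Cantelli in integrated form: by monotone convergence the sum has finite integral,
  so it is finite almost everywhere.\<close>

lemma AE_summable_of_summable_nn_integral:
  assumes "\<And>n. Z n \<in> borel_measurable M"
    and "(\<Sum>n. \<integral>\<^sup>+\<omega>. ennreal (Z n \<omega>) \<partial>M) < \<infinity>" and "\<And>n \<omega>. Z n \<omega> \<ge> 0"
  shows "AE \<omega> in M. summable (\<lambda>n. Z n \<omega>)"
proof -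
  have "(\<integral>\<^sup>+\<omega>. (\<Sum>n. ennreal (Z n \<omega>)) \<partial>M) < \<infinity>"
    using assms by (subst nn_integral_suminf) auto
  then have "AE \<omega> in M. (\<Sum>n. ennreal (Z n \<omega>)) \<noteq> \<infinity>"
    using assms(1) by (intro nn_integral_PInf_AE) auto
  then show ?thesis
    by eventually_elim (auto intro: summable_suminf_not_top assms(3))
qed

text \<open>The limit differs from \<open>a n\<close> by a telescoping tail, dominated by a
  geometric series with first term \<open>K * r ^ Suc n\<close>.\<close>

lemma geometric_increments_limit:
  fixes a :: "nat \<Rightarrow> real"
  assumes "0 < r" "r < 1" and step: "\<And>n. \<bar>a (Suc n) - a n\<bar> \<le> K * r ^ Suc n"
  shows "convergent a" and "\<bar>lim a - a n\<bar> \<le> K * r ^ Suc n / (1 - r)"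
proof -
  have geo: "(\<lambda>i. K * r ^ Suc n * r ^ i) sums (K * r ^ Suc n * (1 / (1 - r)))" for n
    using assms(1,2) by (intro sums_mult geometric_sums) auto
  have step': "\<bar>a (Suc (i + n)) - a (i + n)\<bar> \<le> K * r ^ Suc n * r ^ i" for i n
    using step[of "i + n"] by (simp add: power_add mult_ac)
  have summ: "summable (\<lambda>i. \<bar>a (Suc (i + n)) - a (i + n)\<bar>)" for n
    by (rule summable_comparison_test'[OF sums_summable[OF geo[of n]], of 0])
       (use step' in auto)
  have tel: "(\<Sum>i<k. a (Suc (i + n)) - a (i + n)) = a (k + n) - a n" for k n
    by (induction k) auto
  have conv: "(\<lambda>k. a (k + n) - a n) \<longlonglongrightarrow> (\<Sum>i. a (Suc (i + n)) - a (i + n))" for n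
    using summable_LIMSEQ[OF summable_rabs_cancel[OF summ[of n]]] by (simp add: tel)
  have "a \<longlonglongrightarrow> (\<Sum>i. a (Suc i) - a i) + a 0"
    using tendsto_add[OF conv[of 0] tendsto_const[of "a 0"]] by simp
  then show "convergent a" by (auto simp: convergent_def)
  then have "a \<longlonglongrightarrow> lim a" by (simp add: convergent_LIMSEQ_iff)
  then have "(\<lambda>k. a (k + n) - a n) \<longlonglongrightarrow> lim a - a n"
    by (rule tendsto_diff[OF LIMSEQ_ignore_initial_segment tendsto_const])
  with conv have "lim a - a n = (\<Sum>i. a (Suc (i + n)) - a (i + n))"
    by (metis LIMSEQ_unique)
  also have "\<bar>\<dots>\<bar> \<le> (\<Sum>i. \<bar>a (Suc (i + n)) - a (i + n)\<bar>)"
    by (rule summable_rabs[OF summ])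
  also have "\<dots> \<le> K * r ^ Suc n / (1 - r)"
    using suminf_le[OF step' summ sums_summable[OF geo], of n] sums_unique[OF geo[of n]] by simp
  finally show "\<bar>lim a - a n\<bar> \<le> K * r ^ Suc n / (1 - r)" .
qed

section \<open>The dyadic grid and deterministic chaining\<close>

text \<open>At \<open>t = T\<close> the index is \<open>2 ^ n\<close>, one more than the index of
  the last block of level \<open>n\<close>.\<close>

definition dyadic_index :: "real \<Rightarrow> nat \<Rightarrow> real \<Rightarrow> nat" where
  "dyadic_index T n t = nat \<lfloor>2 ^ n * t / T\<rfloor>"

definition dyadic_floor :: "real \<Rightarrow> nat \<Rightarrow> real \<Rightarrow> real" where
  "dyadic_floor T n t = T * real (dyadic_index T n t) / 2 ^ n"

lemma dyadic_floor_bounds: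
  assumes "T > 0" "0 \<le> t"
  shows "0 \<le> dyadic_floor T n t" "dyadic_floor T n t \<le> t" "t - dyadic_floor T n t \<le> T / 2 ^ n"
proof -
  have nn: "2 ^ n * t / T \<ge> 0" using assms by simp
  then have "real (dyadic_index T n t) = of_int \<lfloor>2 ^ n * t / T\<rfloor>"
    by (simp add: dyadic_index_def)
  then have "real (dyadic_index T n t) \<le> 2 ^ n * t / T"
    "2 ^ n * t / T \<le> real (dyadic_index T n t) + 1" by linarith+
  then have "dyadic_floor T n t \<le> T * (2 ^ n * t / T) / 2 ^ n"
    "T * (2 ^ n * t / T) / 2 ^ n \<le> T * (real (dyadic_index T n t) + 1) / 2 ^ n"
    unfolding dyadic_floor_def using assms by (intro divide_right_mono mult_left_mono; simp)+
  moreover have "T * (2 ^ n * t / T) / 2 ^ n = t" using assms by simp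
  moreover have "T * (real (dyadic_index T n t) + 1) / 2 ^ n = dyadic_floor T n t + T / 2 ^ n"
    by (simp add: dyadic_floor_def distrib_left add_divide_distrib)
  ultimately show "dyadic_floor T n t \<le> t" "t - dyadic_floor T n t \<le> T / 2 ^ n"
    by linarith+
  show "0 \<le> dyadic_floor T n t" using assms by (simp add: dyadic_floor_def)
qed

lemma dyadic_index_le:
  assumes "T > 0" "t \<le> T"
  shows "dyadic_index T n t \<le> 2 ^ n"
proof -
  have "2 ^ n * t / T \<le> 2 ^ n" using assms by (simp add: field_simps)
  then have "\<lfloor>2 ^ n * t / T\<rfloor> \<le> 2 ^ n" by (simp add: floor_le_iff)
  then show ?thesis unfolding dyadic_index_def by (simp add: nat_le_iff)
qed

text \<open>Doubling a number doubles its floor or exceeds that by one. Hence successive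
  approximations of \<open>t\<close> coincide or are neighbours on the finer grid, and chaining
  meets only grid increments.\<close>

lemma dyadic_index_Suc:
  assumes "T > 0" "0 \<le> t"
  shows "dyadic_index T (Suc n) t = 2 * dyadic_index T n t \<or>
         dyadic_index T (Suc n) t = Suc (2 * dyadic_index T n t)"
proof -
  define x where "x = 2 ^ n * t / T"
  have "x \<ge> 0" using assms by (simp add: x_def)
  have "2 ^ Suc n * t / T = 2 * x" by (simp add: x_def)
  moreover have "\<lfloor>2 * x\<rfloor> = 2 * \<lfloor>x\<rfloor> \<or> \<lfloor>2 * x\<rfloor> = 2 * \<lfloor>x\<rfloor> + 1" by linarith
  ultimately show ?thesis
    using \<open>x \<ge> 0\<close> unfolding dyadic_index_def x_def[symmetric]
    by (auto simp: nat_mult_distrib nat_add_distrib)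
qed

text \<open>Numbers at most 1 apart have floors at most 1 apart, so nearby points are separated by
  at most one grid increment of level \<open>n\<close>.\<close>

lemma dyadic_index_near:
  assumes "T > 0" "0 \<le> s" "s \<le> t" "t - s \<le> T / 2 ^ n"
  shows "dyadic_index T n t = dyadic_index T n s \<or> dyadic_index T n t = Suc (dyadic_index T n s)"
proof -
  define x y where "x = 2 ^ n * s / T" and "y = 2 ^ n * t / T"
  have "x \<ge> 0" "x \<le> y" "y \<le> x + 1" using assms by (auto simp: x_def y_def field_simps)
  then have "\<lfloor>y\<rfloor> = \<lfloor>x\<rfloor> \<or> \<lfloor>y\<rfloor> = \<lfloor>x\<rfloor> + 1" by linarith
  then show ?thesis
    using \<open>x \<ge> 0\<close> unfolding dyadic_index_def x_def[symmetric] y_def[symmetric]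
    by (auto simp: nat_add_distrib)
qed

text \<open>Chaining: two points at distance about \<open>T / 2 ^ n\<close> are connected by at most
  one grid increment of level \<open>n\<close> and, on each side, by a geometric tail of finer
  increments. Since \<open>f\<close> is controlled on the grid only, the conclusion concerns its
  limits along \<open>dyadic_floor\<close>.\<close>

lemma dyadic_increments_imp_Holder:
  fixes f :: "real \<Rightarrow> real"
  assumes "T > 0" "\<gamma> > 0"
    and inc: "\<And>n k. k < 2 ^ n \<Longrightarrow>
      \<bar>f (T * real (Suc k) / 2 ^ n) - f (T * real k / 2 ^ n)\<bar> \<le> K * (2 powr - \<gamma>) ^ n"
  shows "\<exists>C>0. \<forall>s\<in>{0..T}. \<forall>t\<in>{0..T}.
    \<bar>lim (\<lambda>n. f (dyadic_floor T n s)) - lim (\<lambda>n. f (dyadic_floor T n t))\<bar> \<le> C * \<bar>s - t\<bar> powr \<gamma>"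
proof -
  define r :: real where "r = 2 powr - \<gamma>"
  define F where "F t = lim (\<lambda>n. f (dyadic_floor T n t))" for t
  have r: "0 < r" "r < 1" using \<open>\<gamma> > 0\<close> by (auto simp: r_def powr_minus_divide)
  have K: "K \<ge> 0" using inc[of 0 0] by simp
  have r_pow: "r ^ n = (1 / 2 ^ n) powr \<gamma>" for n
  proof -
    have "r ^ n = 2 powr (- \<gamma> * real n)"
      using r by (simp add: r_def powr_powr flip: powr_realpow)
    also have "\<dots> = (2 powr (- real n)) powr \<gamma>"
      by (simp add: powr_powr mult.commute)
    also have "2 powr (- real n) = 1 / (2::real) ^ n"
      by (simp add: powr_minus_divide powr_realpow)
    finally show ?thesis .
  qed
  have step: "\<bar>f (dyadic_floor T (Suc n) t) - f (dyadic_floor T n t)\<bar> \<le> K * r ^ Suc n"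
    if t: "t \<in> {0..T}" for n t
  proof -
    let ?j = "dyadic_index T n t"
    have eq: "dyadic_floor T n t = T * real (2 * ?j) / 2 ^ Suc n" by (simp add: dyadic_floor_def)
    consider "dyadic_index T (Suc n) t = 2 * ?j" | "dyadic_index T (Suc n) t = Suc (2 * ?j)"
      using dyadic_index_Suc[of T t n] t \<open>T > 0\<close> by auto
    then show ?thesis
    proof cases
      case 1
      then have "dyadic_floor T (Suc n) t = dyadic_floor T n t"
        unfolding eq by (simp add: dyadic_floor_def)
      then show ?thesis using K r by simp
    next
      case 2
      have "2 * ?j < 2 ^ Suc n"
        using dyadic_index_le[of T t "Suc n"] t \<open>T > 0\<close> 2 by auto
      from inc[OF this] show ?thesis
        unfolding eq dyadic_floor_def[of T "Suc n"] 2 r_def .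
    qed
  qed
  have tail: "\<bar>F t - f (dyadic_floor T n t)\<bar> \<le> K * r ^ Suc n / (1 - r)" if "t \<in> {0..T}" for n t
    unfolding F_def by (rule geometric_increments_limit(2)[OF r step[OF that]])
  \<comment> \<open>Two tails give \<open>2 * K / (1 - r)\<close>, and the middle increment gives
    \<open>K / r\<close> once written against \<open>r ^ Suc n\<close>. The summand 1 keeps
    \<open>C\<close> positive when \<open>K = 0\<close>.\<close>
  define C where "C = (2 * K / (1 - r) + K / r) * (1 / T) powr \<gamma> + 1"
  have "C > 0" using K r by (auto simp: C_def intro!: add_nonneg_pos mult_nonneg_nonneg)
  have main: "\<bar>F s - F t\<bar> \<le> C * \<bar>s - t\<bar> powr \<gamma>" if st: "0 \<le> s" "s < t" "t \<le> T" for s t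
  proof -
    define x where "x = T / (t - s)"
    have "x \<ge> 1" using st by (simp add: x_def)
    obtain n0 where n0: "x < 2 ^ n0" using real_arch_pow[of 2 x] by auto
    \<comment> \<open>The level with \<open>T / 2 ^ Suc n < t - s \<le> T / 2 ^ n\<close>: close
      enough for equal or neighbouring cells, far enough to absorb \<open>r ^ Suc n\<close> into a
      power of \<open>t - s\<close>.\<close>
    define n where "n = (LEAST n. x < 2 ^ Suc n)"
    have n1: "x < 2 ^ Suc n" unfolding n_def
      by (rule LeastI[of _ n0]) (use n0 \<open>x \<ge> 1\<close> in auto)
    have n2: "2 ^ n \<le> x"
    proof (cases n)
      case (Suc m)
      then have "\<not> x < 2 ^ Suc m" using not_less_Least[of m "\<lambda>n. x < 2 ^ Suc n"] by (simp add: n_def)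
      then show ?thesis using Suc by simp
    qed (use \<open>x \<ge> 1\<close> in simp)
    have close: "t - s \<le> T / 2 ^ n" and far: "1 / 2 ^ Suc n \<le> (t - s) / T"
      using n1 n2 st \<open>T > 0\<close> by (auto simp: x_def field_simps)
    have mid: "\<bar>f (dyadic_floor T n t) - f (dyadic_floor T n s)\<bar> \<le> K * r ^ n"
    proof -
      consider "dyadic_index T n t = dyadic_index T n s"
        | "dyadic_index T n t = Suc (dyadic_index T n s)"
        using dyadic_index_near[OF \<open>T > 0\<close> st(1) _ close] st by auto
      then show ?thesis
      proof cases
        case 1 then show ?thesis using K r by (simp add: dyadic_floor_def)
      next
        case 2
        have "dyadic_index T n s < 2 ^ n"
          using dyadic_index_le[of T t n] st \<open>T > 0\<close> 2 by auto
        from inc[OF this] show ?thesis unfolding dyadic_floor_def 2 r_def .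
      qed
    qed
    have "\<bar>F s - F t\<bar> \<le> 2 * (K * r ^ Suc n / (1 - r)) + K * r ^ n"
      using tail[of s n] tail[of t n] mid st unfolding atLeastAtMost_iff by linarith
    also have "\<dots> = (2 * K / (1 - r) + K / r) * r ^ Suc n"
      using r by (simp add: distrib_right mult.assoc)
    also have "\<dots> \<le> (2 * K / (1 - r) + K / r) * ((t - s) / T) powr \<gamma>"
      unfolding r_pow using far \<open>\<gamma> > 0\<close> K r
      by (intro mult_left_mono powr_mono2) auto
    also have "\<dots> = (2 * K / (1 - r) + K / r) * (1 / T) powr \<gamma> * (t - s) powr \<gamma>"
      using st \<open>T > 0\<close> by (simp add: powr_divide)
    also have "\<dots> \<le> C * (t - s) powr \<gamma>"
      unfolding C_def by (intro mult_right_mono) auto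
    finally show ?thesis using st by (simp add: abs_minus_commute)
  qed
  have "\<bar>F s - F t\<bar> \<le> C * \<bar>s - t\<bar> powr \<gamma>" if "s \<in> {0..T}" "t \<in> {0..T}" for s t
    using main[of s t] main[of t s] that
    by (cases s t rule: linorder_cases) (auto simp: abs_minus_commute)
  then show ?thesis using \<open>C > 0\<close> unfolding F_def by blast
qed

section \<open>Kolmogorov--Chentsov: positive moments and the modification\<close>

text \<open>The constant is the moment of order \<open>q\<close> of \<open>X 1 - X 0\<close>;
  obtaining it as a real number keeps later computations in the reals.\<close>

lemma sssi_increment_moment_finite:
  assumes sssi: "sssi M H X" and meas: "\<And>t. t \<ge> 0 \<Longrightarrow> X t \<in> borel_measurable M"
    and int: "\<And>t. t \<ge> 0 \<Longrightarrow> integrable M (\<lambda>\<omega>. \<bar>X t \<omega>\<bar> powr q)" and "q > 0"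
  obtains m where "m \<ge> 0" and "\<And>s t. 0 \<le> s \<Longrightarrow> s < t \<Longrightarrow>
    (\<integral>\<^sup>+\<omega>. ennreal (\<bar>X t \<omega> - X s \<omega>\<bar> powr q) \<partial>M) = ennreal (m * (t - s) powr (H * q))"
proof -
  let ?I = "\<integral>\<^sup>+\<omega>. ennreal (\<bar>X 1 \<omega> - X 0 \<omega>\<bar> powr q) \<partial>M"
  have "integrable M (\<lambda>\<omega>. \<bar>X 1 \<omega> - X 0 \<omega>\<bar> powr q)"
  proof (rule Bochner_Integration.integrable_bound)
    show "integrable M (\<lambda>\<omega>. 2 powr q * (\<bar>X 1 \<omega>\<bar> powr q + \<bar>X 0 \<omega>\<bar> powr q))"
      using int by (intro integrable_mult_right Bochner_Integration.integrable_add) auto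
    show "(\<lambda>\<omega>. \<bar>X 1 \<omega> - X 0 \<omega>\<bar> powr q) \<in> borel_measurable M"
      using meas[of 0] meas[of 1] by measurable
    show "AE \<omega> in M. norm (\<bar>X 1 \<omega> - X 0 \<omega>\<bar> powr q)
        \<le> norm (2 powr q * (\<bar>X 1 \<omega>\<bar> powr q + \<bar>X 0 \<omega>\<bar> powr q))"
      using powr_abs_diff_le[OF \<open>q > 0\<close>] by (auto intro!: AE_I2)
  qed
  then have "?I < \<infinity>"
    unfolding integrable_iff_bounded by simp
  then obtain m where m: "m \<ge> 0" "?I = ennreal m"
    by (cases ?I) auto
  show thesis
    using sssi_increment_moment[OF sssi meas, of _ _ q] m
    by (intro that[of m]) (auto simp: ennreal_mult)
qed

text \<open>Kolmogorov's moment method: a high moment, summed over the \<open>2 ^ n\<close> cells,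
  beats the weight that the exponent \<gamma> demands.\<close>

lemma sssi_dyadic_increments:
  assumes sssi: "sssi M H X" and meas: "\<And>t. t \<ge> 0 \<Longrightarrow> X t \<in> borel_measurable M"
    and int: "\<And>q t. q > 0 \<Longrightarrow> t \<ge> 0 \<Longrightarrow> integrable M (\<lambda>\<omega>. \<bar>X t \<omega>\<bar> powr q)"
    and "\<gamma> < H" "T > 0"
  shows "AE \<omega> in M. \<exists>K. \<forall>n k. k < 2 ^ n \<longrightarrow>
    \<bar>X (T * real (Suc k) / 2 ^ n) \<omega> - X (T * real k / 2 ^ n) \<omega>\<bar> \<le> K * (2 powr - \<gamma>) ^ n"
proof -
  \<comment> \<open>With \<open>q * (H - \<gamma>) = 2\<close>, the weight, the number of cells and
    the moment combine to \<open>2 powr (n * (1 - q * (H - \<gamma>)))\<close>, that is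
    \<open>(1 / 2) ^ n\<close>, up to a constant.\<close>
  define q where "q = 2 / (H - \<gamma>)"
  have "H - \<gamma> > 0" using \<open>\<gamma> < H\<close> by simp
  then have q: "q > 0" "q * (H - \<gamma>) = 2"
    using nonzero_eq_divide_eq[of "H - \<gamma>" q 2] by (auto simp: q_def)
  obtain m where m: "m \<ge> 0" "\<And>s t. 0 \<le> s \<Longrightarrow> s < t \<Longrightarrow>
    (\<integral>\<^sup>+\<omega>. ennreal (\<bar>X t \<omega> - X s \<omega>\<bar> powr q) \<partial>M) = ennreal (m * (t - s) powr (H * q))"
    using sssi_increment_moment_finite[OF sssi meas int[OF q(1)] q(1)] by metis
  define D where "D n k \<omega> = \<bar>X (T * real (Suc k) / 2 ^ n) \<omega> - X (T * real k / 2 ^ n) \<omega>\<bar>" for n k \<omega>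
  \<comment> \<open>Under this weight, \<open>Z n \<omega> \<le> B\<close> forces \<open>D n k
    \<omega> \<le> B powr (1 / q) * (2 powr - \<gamma>) ^ n\<close> for every cell
    \<open>k < 2 ^ n\<close>.\<close>
  define Z where "Z n \<omega> = 2 powr (\<gamma> * q * real n) * (\<Sum>k<(2::nat) ^ n. D n k \<omega> powr q)" for n \<omega>
  have D [measurable]: "D n k \<in> borel_measurable M" for n k
    unfolding D_def using meas \<open>T > 0\<close> by (intro borel_measurable_abs borel_measurable_diff) auto
  have Z_nonneg: "Z n \<omega> \<ge> 0" for n \<omega>
    unfolding Z_def by (intro mult_nonneg_nonneg sum_nonneg) auto
  have "(\<integral>\<^sup>+\<omega>. ennreal (Z n \<omega>) \<partial>M) = ennreal (m * T powr (H * q) * (1 / 2) ^ n)" for n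
  proof -
    have "(\<integral>\<^sup>+\<omega>. ennreal (D n k \<omega> powr q) \<partial>M) = ennreal (m * (T / 2 ^ n) powr (H * q))" for k
      using m(2)[of "T * real k / 2 ^ n" "T * real (Suc k) / 2 ^ n"] \<open>T > 0\<close>
      by (simp add: D_def field_simps flip: diff_divide_distrib)
    then have "(\<integral>\<^sup>+\<omega>. ennreal (Z n \<omega>) \<partial>M) =
        ennreal (2 powr (\<gamma> * q * real n)) * (\<Sum>k<(2::nat) ^ n. ennreal (m * (T / 2 ^ n) powr (H * q)))"
      by (simp add: Z_def ennreal_mult sum_nonneg nn_integral_cmult nn_integral_sum flip: sum_ennreal)
    also have "\<dots> = ennreal (2 powr (\<gamma> * q * real n) * (2 ^ n * (m * (T / 2 ^ n) powr (H * q))))"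
      using m(1) by (simp add: ennreal_mult ennreal_of_nat_eq_real_of_nat)
    also have "2 powr (\<gamma> * q * real n) * (2 ^ n * (m * (T / 2 ^ n) powr (H * q))) =
        m * T powr (H * q) * (2 powr (\<gamma> * q * real n) * 2 powr (real n) / 2 powr (real n * (H * q)))"
      using \<open>T > 0\<close> by (simp add: powr_divide powr_powr powr_realpow[symmetric])
    also have "2 powr (\<gamma> * q * real n) * 2 powr (real n) / 2 powr (real n * (H * q)) =
        (2::real) powr (real n * (1 - q * (H - \<gamma>)))"
      unfolding powr_add[symmetric] powr_diff[symmetric] by (simp add: algebra_simps)
    also have "\<dots> = (1 / 2) ^ n"
      unfolding q by (simp add: powr_minus_divide powr_realpow power_one_over)
    finally show ?thesis .
  qed
  then have "(\<Sum>n. \<integral>\<^sup>+\<omega>. ennreal (Z n \<omega>) \<partial>M) = ennreal (\<Sum>n. m * T powr (H * q) * (1 / 2) ^ n)"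
    using m(1) by (simp only:) (rule suminf_ennreal2, simp, rule summable_mult, rule summable_geometric, simp)
  then have "AE \<omega> in M. summable (\<lambda>n. Z n \<omega>)"
    using Z_nonneg by (intro AE_summable_of_summable_nn_integral) (auto simp: Z_def)
  then show ?thesis
  proof eventually_elim
    fix \<omega> assume "summable (\<lambda>n. Z n \<omega>)"
    \<comment> \<open>Summable terms are bounded, which yields a constant valid from level 0 on and
      not merely for large \<open>n\<close>.\<close>
    then have "Bseq (\<lambda>n. Z n \<omega>)"
      by (intro convergent_imp_Bseq convergentI[OF summable_LIMSEQ_zero])
    then obtain B where B: "B > 0" "\<And>n. Z n \<omega> \<le> B"
      by (metis BseqE real_norm_def abs_le_D1)
    have "D n k \<omega> \<le> B powr (1 / q) * (2 powr - \<gamma>) ^ n" if "k < 2 ^ n" for n k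
    proof -
      have "D n k \<omega> powr q \<le> (\<Sum>k<(2::nat) ^ n. D n k \<omega> powr q)"
        using that by (intro member_le_sum) auto
      then have "2 powr (\<gamma> * q * real n) * D n k \<omega> powr q \<le> B"
        using B(2)[of n] by (auto simp: Z_def intro: order_trans[OF mult_left_mono])
      then have "(2 powr (\<gamma> * q * real n) * D n k \<omega> powr q) powr (1 / q) \<le> B powr (1 / q)"
        using q by (intro powr_mono2) auto
      then have "2 powr (\<gamma> * real n) * D n k \<omega> \<le> B powr (1 / q)"
        using q by (simp add: powr_mult powr_powr D_def)
      moreover have "(2 powr - \<gamma>) ^ n = 1 / 2 powr (\<gamma> * real n)"
        using powr_minus_divide[of 2 "\<gamma> * real n"] by (simp add: powr_powr flip: powr_realpow)
      ultimately show ?thesis by (simp add: pos_le_divide_eq mult.commute)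
    qed
    then show "\<exists>K. \<forall>n k. k < 2 ^ n \<longrightarrow>
      \<bar>X (T * real (Suc k) / 2 ^ n) \<omega> - X (T * real k / 2 ^ n) \<omega>\<bar> \<le> K * (2 powr - \<gamma>) ^ n"
      unfolding D_def by blast
  qed
qed

text \<open>The exceptional set may depend on the fixed time \<open>t\<close>; this suffices for a
  modification.\<close>

lemma dyadic_floor_limit_AE:
  assumes sssi: "sssi M H X" and meas: "\<And>t. t \<ge> 0 \<Longrightarrow> X t \<in> borel_measurable M"
    and int: "\<And>q t. q > 0 \<Longrightarrow> t \<ge> 0 \<Longrightarrow> integrable M (\<lambda>\<omega>. \<bar>X t \<omega>\<bar> powr q)"
    and "H > 0" "T > 0" "t \<ge> 0"
  shows "AE \<omega> in M. (\<lambda>n. X (dyadic_floor T n t) \<omega>) \<longlonglongrightarrow> X t \<omega>"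
proof -
  \<comment> \<open>This order makes the moment linear in the distance from \<open>t\<close> to its
    approximation, which is at most \<open>T / 2 ^ n\<close> and hence summable.\<close>
  define q where "q = 1 / H"
  have q: "q > 0" "H * q = 1" using \<open>H > 0\<close> by (auto simp: q_def)
  obtain m where m: "m \<ge> 0" "\<And>s t. 0 \<le> s \<Longrightarrow> s < t \<Longrightarrow>
    (\<integral>\<^sup>+\<omega>. ennreal (\<bar>X t \<omega> - X s \<omega>\<bar> powr q) \<partial>M) = ennreal (m * (t - s) powr (H * q))"
    using sssi_increment_moment_finite[OF sssi meas int[OF q(1)] q(1)] by metis
  define Z where "Z n \<omega> = \<bar>X t \<omega> - X (dyadic_floor T n t) \<omega>\<bar> powr q" for n \<omega>
  note bounds = dyadic_floor_bounds[OF \<open>T > 0\<close> \<open>t \<ge> 0\<close>]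
  have [measurable]: "X t \<in> borel_measurable M" "\<And>n. X (dyadic_floor T n t) \<in> borel_measurable M"
    using meas bounds(1) \<open>t \<ge> 0\<close> by auto
  have "(\<integral>\<^sup>+\<omega>. ennreal (Z n \<omega>) \<partial>M) \<le> ennreal (m * T * (1 / 2) ^ n)" for n
  proof (cases "dyadic_floor T n t = t")
    case True
    then show ?thesis using q by (simp add: Z_def)
  next
    case False
    then have lt: "dyadic_floor T n t < t" using bounds(2)[of n] by simp
    then have "(\<integral>\<^sup>+\<omega>. ennreal (Z n \<omega>) \<partial>M) = ennreal (m * (t - dyadic_floor T n t))"
      using m(2)[OF bounds(1) lt] q by (simp add: Z_def)
    also have "\<dots> \<le> ennreal (m * (T * (1 / 2) ^ n))"
      using bounds(3)[of n] m(1) by (intro ennreal_leI mult_left_mono) (auto simp: power_one_over)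
    finally show ?thesis by (simp add: mult.assoc)
  qed
  then have "(\<Sum>n. \<integral>\<^sup>+\<omega>. ennreal (Z n \<omega>) \<partial>M) \<le> (\<Sum>n. ennreal (m * T * (1 / 2) ^ n))"
    by (intro suminf_le) auto
  also have "\<dots> = ennreal (\<Sum>n. m * T * (1 / 2) ^ n)"
    using m(1) \<open>T > 0\<close> by (intro suminf_ennreal2 summable_mult summable_geometric) auto
  also have "\<dots> < \<infinity>" by simp
  finally have "AE \<omega> in M. summable (\<lambda>n. Z n \<omega>)"
    by (intro AE_summable_of_summable_nn_integral) (auto simp: Z_def)
  then show ?thesis
  proof eventually_elim
    fix \<omega> assume "summable (\<lambda>n. Z n \<omega>)"
    then have "(\<lambda>n. Z n \<omega> powr (1 / q)) \<longlonglongrightarrow> 0 powr (1 / q)"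
      using q by (intro tendsto_powr' summable_LIMSEQ_zero) (auto simp: Z_def)
    then have "(\<lambda>n. \<bar>X t \<omega> - X (dyadic_floor T n t) \<omega>\<bar>) \<longlonglongrightarrow> 0"
      using q by (simp add: Z_def powr_powr)
    then have "(\<lambda>n. X t \<omega> - (X t \<omega> - X (dyadic_floor T n t) \<omega>)) \<longlonglongrightarrow> X t \<omega> - 0"
      by (intro tendsto_diff tendsto_const) (simp add: tendsto_rabs_zero_iff)
    then show "(\<lambda>n. X (dyadic_floor T n t) \<omega>) \<longlonglongrightarrow> X t \<omega>" by simp
  qed
qed

lemma sssi_Holder_modification_exists:
  assumes sssi: "sssi M H X" and meas: "\<And>t. t \<ge> 0 \<Longrightarrow> X t \<in> borel_measurable M"
    and int: "\<And>q t. q > 0 \<Longrightarrow> t \<ge> 0 \<Longrightarrow> integrable M (\<lambda>\<omega>. \<bar>X t \<omega>\<bar> powr q)"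
    and "H > 0" "T > 0"
  shows "\<exists>Y. Holder_modification M H T X Y"
proof -
  \<comment> \<open>\<open>lim\<close> is total, so \<open>Y\<close> is defined and measurable
    everywhere; at each fixed time it is almost surely a true limit.\<close>
  define Y where "Y t \<omega> = lim (\<lambda>n. X (dyadic_floor T n t) \<omega>)" for t \<omega>
  have "modification_on M {0..T} X Y"
    unfolding modification_on_def
  proof (intro ballI conjI)
    fix t assume t: "t \<in> {0..T}"
    show "Y t \<in> borel_measurable M"
      unfolding Y_def using t \<open>T > 0\<close>
      by (intro borel_measurable_lim_metric meas dyadic_floor_bounds) auto
    have "t \<ge> 0" using t by simp
    from dyadic_floor_limit_AE[OF sssi meas int \<open>H > 0\<close> \<open>T > 0\<close> this]
    show "AE \<omega> in M. Y t \<omega> = X t \<omega>"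
      unfolding Y_def by (auto elim!: eventually_mono intro: limI)
  qed
  moreover have "AE \<omega> in M. \<forall>\<gamma>\<in>{0<..<H}. locally_Holder_on {0..T} \<gamma> (\<lambda>t. Y t \<omega>)"
  proof -
    \<comment> \<open>Rational exponents give one null set for all \<gamma>; a rational strictly
      between \<gamma> and \<open>H\<close> then yields the bound for \<gamma>.\<close>
    have "AE \<omega> in M. \<forall>p::rat. of_rat p < H \<longrightarrow> (\<exists>K. \<forall>n k. k < 2 ^ n \<longrightarrow>
      \<bar>X (T * real (Suc k) / 2 ^ n) \<omega> - X (T * real k / 2 ^ n) \<omega>\<bar> \<le> K * (2 powr - of_rat p) ^ n)"
      using sssi_dyadic_increments[OF sssi meas int _ \<open>T > 0\<close>]
      by (intro AE_all_countable[THEN iffD2] allI AE_impI)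
    then show ?thesis
    proof eventually_elim
      fix \<omega> assume inc: "\<forall>p::rat. of_rat p < H \<longrightarrow> (\<exists>K. \<forall>n k. k < 2 ^ n \<longrightarrow>
      \<bar>X (T * real (Suc k) / 2 ^ n) \<omega> - X (T * real k / 2 ^ n) \<omega>\<bar> \<le> K * (2 powr - of_rat p) ^ n)"
      show "\<forall>\<gamma>\<in>{0<..<H}. locally_Holder_on {0..T} \<gamma> (\<lambda>t. Y t \<omega>)"
      proof
        fix \<gamma> assume \<gamma>: "\<gamma> \<in> {0<..<H}"
        then obtain p :: rat where p: "\<gamma> < of_rat p" "of_rat p < H" using of_rat_dense by auto
        with inc obtain K where K: "\<And>n k. k < 2 ^ n \<Longrightarrow>
          \<bar>X (T * real (Suc k) / 2 ^ n) \<omega> - X (T * real k / 2 ^ n) \<omega>\<bar> \<le> K * (2 powr - of_rat p) ^ n"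
          by blast
        have "K \<ge> 0" using K[of 0 0] by simp
        have inc_\<gamma>: "\<bar>X (T * real (Suc k) / 2 ^ n) \<omega> - X (T * real k / 2 ^ n) \<omega>\<bar> \<le> K * (2 powr - \<gamma>) ^ n"
          if "k < 2 ^ n" for n k
        proof -
          have "(2 powr - of_rat p) ^ n \<le> (2 powr - \<gamma>) ^ n"
            using p by (intro power_mono powr_mono) auto
          then show ?thesis using K[OF that] \<open>K \<ge> 0\<close> by (meson mult_left_mono order_trans)
        qed
        from dyadic_increments_imp_Holder[OF \<open>T > 0\<close> _ inc_\<gamma>] \<gamma>
        obtain C where "C > 0" "\<forall>s\<in>{0..T}. \<forall>t\<in>{0..T}. \<bar>Y s \<omega> - Y t \<omega>\<bar> \<le> C * \<bar>s - t\<bar> powr \<gamma>"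
          unfolding Y_def by auto
        then show "locally_Holder_on {0..T} \<gamma> (\<lambda>t. Y t \<omega>)"
          unfolding locally_Holder_on_def by (intro ballI exI[of _ UNIV] exI[of _ C]) auto
      qed
    qed
  qed
  ultimately show ?thesis unfolding Holder_modification_def by blast
qed

section \<open>Negative moments and lower bounds for block oscillations\<close>

text \<open>Block \<open>k\<close> of level \<open>n\<close> starts at
  \<open>s = T * k / 2 ^ n\<close>. Its points have the form \<open>s + h * l\<close>, with
  \<open>real l - 1\<close> for the earlier end, to match the joint scaling and the negative-moment
  hypothesis.\<close>

definition block_max :: "real \<Rightarrow> nat \<Rightarrow> (real \<Rightarrow> real) \<Rightarrow> nat \<Rightarrow> nat \<Rightarrow> real" where
  "block_max T m f n k =
     Max ((\<lambda>l. \<bar>f (T * real k / 2 ^ n + T / (real m * 2 ^ n) * real l)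
              - f (T * real k / 2 ^ n + T / (real m * 2 ^ n) * (real l - 1))\<bar>) ` {1..m})"

lemma ext_powr_measurable [measurable]: "(\<lambda>x. ext_powr x \<alpha>) \<in> borel_measurable borel"
  unfolding ext_powr_def
proof (rule measurable_If)
  show "{x \<in> space borel. x = 0 \<and> \<alpha> < 0} \<in> sets (borel :: real measure)"
    by (cases "\<alpha> < 0") auto
qed auto

lemma ext_powr_mult:
  assumes "a > 0" "x \<ge> 0"
  shows "ext_powr (a * x) \<alpha> = ennreal (a powr \<alpha>) * ext_powr x \<alpha>"
proof (cases "x = 0 \<and> \<alpha> < 0")
  case True
  then show ?thesis using \<open>a > 0\<close> by (simp add: ext_powr_def ennreal_mult_top)
next
  case False
  then have "ext_powr x \<alpha> = ennreal (x powr \<alpha>)" "ext_powr (a * x) \<alpha> = ennreal ((a * x) powr \<alpha>)"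
    using \<open>a > 0\<close> by (auto simp: ext_powr_def)
  then show ?thesis
    by (simp add: powr_mult ennreal_mult)
qed

text \<open>The pathwise core of Markov's inequality for a negative power: if
  \<open>0 < x < a\<close>, then \<open>(x / a) powr \<alpha>\<close> is at least 1. The value
  \<infinity> of \<open>ext_powr\<close> at 0 excludes \<open>x = 0\<close>.\<close>

lemma ext_powr_bound:
  assumes "a > 0" "x \<ge> 0" "\<alpha> < 0" and less: "ennreal (a powr - \<alpha>) * ext_powr x \<alpha> < 1"
  shows "a \<le> x"
proof (rule ccontr)
  assume "\<not> a \<le> x"
  show False
  proof (cases "x = 0")
    case True
    then show False using assms by (simp add: ext_powr_def ennreal_mult_top)
  next
    case False
    then have "a powr \<alpha> \<le> x powr \<alpha>"
      using assms \<open>\<not> a \<le> x\<close> by (intro powr_mono2') auto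
    then have "a powr - \<alpha> * a powr \<alpha> \<le> a powr - \<alpha> * x powr \<alpha>"
      by (intro mult_left_mono) auto
    moreover have "a powr - \<alpha> * a powr \<alpha> = 1"
      using \<open>a > 0\<close> by (simp flip: powr_add)
    moreover have "ennreal (a powr - \<alpha> * x powr \<alpha>) < 1"
      using less False by (simp add: ext_powr_def ennreal_mult)
    ultimately show False
      by (metis ennreal_1 ennreal_leI leD)
  qed
qed

text \<open>Borel--Cantelli with Markov's inequality built in: the terms of an almost surely
  convergent series eventually drop below 1. Values are extended, since negative powers may be
  infinite.\<close>

lemma AE_eventually_less_one:
  fixes S :: "nat \<Rightarrow> 'a \<Rightarrow> ennreal"
  assumes [measurable]: "\<And>n. S n \<in> borel_measurable M"
    and "(\<Sum>n. \<integral>\<^sup>+\<omega>. S n \<omega> \<partial>M) < \<infinity>"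
  shows "AE \<omega> in M. \<forall>\<^sub>F n in sequentially. S n \<omega> < 1"
proof -
  have "(\<integral>\<^sup>+\<omega>. (\<Sum>n. S n \<omega>) \<partial>M) < \<infinity>"
    using assms by (subst nn_integral_suminf) auto
  then have "AE \<omega> in M. (\<Sum>n. S n \<omega>) \<noteq> \<infinity>"
    by (intro nn_integral_PInf_AE) auto
  then show ?thesis
  proof eventually_elim
    fix \<omega> assume fin: "(\<Sum>n. S n \<omega>) \<noteq> \<infinity>"
    have eq: "S n \<omega> = ennreal (enn2real (S n \<omega>))" for n
      using fin ennreal_suminf_lessD[of "\<lambda>n. S n \<omega>" top n] by (simp add: less_top)
    have "summable (\<lambda>n. enn2real (S n \<omega>))"
      using fin eq by (intro summable_suminf_not_top) auto
    then have "\<forall>\<^sub>F n in sequentially. enn2real (S n \<omega>) < 1"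
      by (intro order_tendstoD[OF summable_LIMSEQ_zero]) auto
    then show "\<forall>\<^sub>F n in sequentially. S n \<omega> < 1"
      by eventually_elim (metis eq ennreal_1 ennreal_lessI zero_less_one)
  qed
qed

text \<open>Jointly in its \<open>m\<close> steps, a block with step length \<open>h\<close> is
  distributed as \<open>h powr H\<close> times the unit steps from time 0. The maximum is
  homogeneous, so a factor with exponent \<open>H * \<alpha>\<close> comes out, the same for every
  \<open>k\<close>.\<close>

lemma sssi_block_moment:
  assumes sssi: "sssi M H X" and meas: "\<And>t. t \<ge> 0 \<Longrightarrow> X t \<in> borel_measurable M"
    and "m \<ge> 1" "T > 0"
  shows "(\<integral>\<^sup>+\<omega>. ext_powr (block_max T m (\<lambda>t. X t \<omega>) n k) \<alpha> \<partial>M) =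
    ennreal ((T / (real m * 2 ^ n)) powr (H * \<alpha>)) *
    (\<integral>\<^sup>+\<omega>. ext_powr (Max ((\<lambda>l. \<bar>X (real l) \<omega> - X (real l - 1) \<omega>\<bar>) ` {1..m})) \<alpha> \<partial>M)"
proof -
  define s h where "s = T * real k / 2 ^ n" and "h = T / (real m * 2 ^ n)"
  have sh: "s \<ge> 0" "h > 0" using assms by (auto simp: s_def h_def)
  \<comment> \<open>Time 0 belongs to \<open>J\<close>, since the step \<open>l = 1\<close> starts
    there.\<close>
  define J where "J = real ` {0..m}"
  have J: "finite J" "J \<subseteq> {0..}" by (auto simp: J_def)
  have in_J: "real l \<in> J" "real l - 1 \<in> J" if l: "l \<in> {1..m}" for l
  proof -
    obtain j where j: "l = Suc j" using l by (cases l) auto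
    show "real l \<in> J" unfolding J_def using l by (intro imageI) simp
    have "real j \<in> J" unfolding J_def using l j by (intro imageI) simp
    then show "real l - 1 \<in> J" using j by simp
  qed
  define G :: "(real \<Rightarrow> real) \<Rightarrow> real" where "G x = Max ((\<lambda>l. \<bar>x (real l) - x (real l - 1)\<bar>) ` {1..m})" for x
  have G_restrict: "G (restrict x J) = G x" for x
    unfolding G_def using in_J by (intro arg_cong[where f = Max] image_cong) auto
  have G_measurable: "(\<lambda>\<omega>. G (Z \<omega>)) \<in> borel_measurable N"
    if "\<And>t. t \<in> J \<Longrightarrow> (\<lambda>\<omega>. Z \<omega> t) \<in> borel_measurable N" for Z and N :: "'b measure"
    unfolding G_def
    by (rule borel_measurable_Max, simp, rule borel_measurable_abs, rule borel_measurable_diff)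
       (rule that, erule in_J)+
  have "(\<lambda>x. ext_powr (G x) \<alpha>) \<in> borel_measurable (\<Pi>\<^sub>M t\<in>J. borel)"
    by (rule measurable_compose[OF G_measurable ext_powr_measurable])
       (rule measurable_component_singleton)
  note same_fdd_nn_integral[OF sssi_increments_same_fdd[OF sssi meas sh] J _ _ this]
  moreover have "X (s + h * t) \<in> borel_measurable M" "X t \<in> borel_measurable M" if "t \<in> J" for t
    using that J(2) sh by (auto intro!: meas)
  ultimately have "(\<integral>\<^sup>+\<omega>. ext_powr (G (\<lambda>t. X (s + h * t) \<omega> - X s \<omega>)) \<alpha> \<partial>M) =
      (\<integral>\<^sup>+\<omega>. ext_powr (G (\<lambda>t. h powr H * (X t \<omega> - X 0 \<omega>))) \<alpha> \<partial>M)"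
    using meas[of 0] meas[OF sh(1)] unfolding G_restrict by simp
  \<comment> \<open>The common base value \<open>X s\<close> cancels in each step.\<close>
  moreover have "G (\<lambda>t. X (s + h * t) \<omega> - X s \<omega>) = block_max T m (\<lambda>t. X t \<omega>) n k" for \<omega>
    unfolding G_def block_max_def s_def h_def by simp
  moreover have "G (\<lambda>t. h powr H * (X t \<omega> - X 0 \<omega>)) = h powr H * G (\<lambda>t. X t \<omega>)" for \<omega>
  proof -
    have "mono ((*) (h powr H))" by (auto intro!: monoI mult_left_mono)
    from mono_Max_commute[OF this, of "(\<lambda>l. \<bar>X (real l) \<omega> - X (real l - 1) \<omega>\<bar>) ` {1..m}"] \<open>m \<ge> 1\<close>
    have "h powr H * G (\<lambda>t. X t \<omega>) = Max ((\<lambda>l. h powr H * \<bar>X (real l) \<omega> - X (real l - 1) \<omega>\<bar>) ` {1..m})"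
      by (simp add: G_def image_image)
    also have "\<dots> = G (\<lambda>t. h powr H * (X t \<omega> - X 0 \<omega>))"
      by (simp add: G_def abs_mult flip: right_diff_distrib)
    finally show ?thesis ..
  qed
  moreover have "ext_powr (h powr H * G (\<lambda>t. X t \<omega>)) \<alpha> =
      ennreal (h powr (H * \<alpha>)) * ext_powr (G (\<lambda>t. X t \<omega>)) \<alpha>" for \<omega>
  proof -
    have "G (\<lambda>t. X t \<omega>) \<ge> 0"
      unfolding G_def using \<open>m \<ge> 1\<close> by (subst Max_ge_iff) auto
    then show ?thesis using sh by (simp add: ext_powr_mult powr_powr)
  qed
  moreover have "(\<lambda>\<omega>. ext_powr (G (\<lambda>t. X t \<omega>)) \<alpha>) \<in> borel_measurable M"
    using meas J(2) by (intro measurable_compose[OF G_measurable ext_powr_measurable]) auto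
  ultimately have "(\<integral>\<^sup>+\<omega>. ext_powr (block_max T m (\<lambda>t. X t \<omega>) n k) \<alpha> \<partial>M) =
      ennreal (h powr (H * \<alpha>)) * (\<integral>\<^sup>+\<omega>. ext_powr (G (\<lambda>t. X t \<omega>)) \<alpha> \<partial>M)"
    by (simp add: nn_integral_cmult)
  then show ?thesis unfolding G_def h_def .
qed

lemma block_max_measurable:
  assumes meas: "\<And>t. t \<ge> 0 \<Longrightarrow> X t \<in> borel_measurable M" and "T > 0"
  shows "(\<lambda>\<omega>. block_max T m (\<lambda>t. X t \<omega>) n k) \<in> borel_measurable M"
proof -
  have "T * real k / 2 ^ n + T / (real m * 2 ^ n) * x \<ge> 0" if "x \<ge> 0" for x
    using that \<open>T > 0\<close> by (intro add_nonneg_nonneg mult_nonneg_nonneg) auto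
  then have "X (T * real k / 2 ^ n + T / (real m * 2 ^ n) * x) \<in> borel_measurable M" if "x \<ge> 0" for x
    using that meas by blast
  then show ?thesis
    unfolding block_max_def
    by (intro borel_measurable_Max borel_measurable_abs borel_measurable_diff) auto
qed

text \<open>Markov's inequality and Borel--Cantelli over all blocks. \<open>m\<close> and
  \<open>c\<close> depend on \<gamma> but are fixed before \<omega>; only the level from which the
  bound holds depends on \<omega>.\<close>

lemma sssi_block_max_lower_bound:
  assumes sssi: "sssi M H X" and meas: "\<And>t. t \<ge> 0 \<Longrightarrow> X t \<in> borel_measurable M"
    and "\<gamma> > H" "T > 0"
    and neg_moment: "\<And>\<alpha>. \<alpha> < 0 \<Longrightarrow> \<exists>m::nat. m \<ge> 1 \<and>
      (\<integral>\<^sup>+\<omega>. ext_powr (Max ((\<lambda>l. \<bar>X (real l) \<omega> - X (real l - 1) \<omega>\<bar>) ` {1..m})) \<alpha> \<partial>M) < \<infinity>"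
  shows "\<exists>m\<ge>1. \<exists>c>0. AE \<omega> in M. \<forall>\<^sub>F n in sequentially. \<forall>k<2 ^ n.
    c * (2 powr - \<gamma>) ^ n \<le> block_max T m (\<lambda>t. X t \<omega>) n k"
proof -
  \<comment> \<open>With \<open>\<alpha> * (\<gamma> - H) = - 2\<close>, the weighted sum over
    \<open>2 ^ n\<close> blocks has expectation proportional to
    \<open>2 powr (n * (1 + \<alpha> * (\<gamma> - H)))\<close>, that is
    \<open>(1 / 2) ^ n\<close>.\<close>
  define \<alpha> where "\<alpha> = - 2 / (\<gamma> - H)"
  have "\<gamma> - H > 0" using \<open>\<gamma> > H\<close> by simp
  then have \<alpha>: "\<alpha> < 0" "\<alpha> * (\<gamma> - H) = - 2"
    using nonzero_eq_divide_eq[of "\<gamma> - H" \<alpha> "- 2"] by (auto simp: \<alpha>_def)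
  obtain m where m: "m \<ge> 1" and
    "(\<integral>\<^sup>+\<omega>. ext_powr (Max ((\<lambda>l. \<bar>X (real l) \<omega> - X (real l - 1) \<omega>\<bar>) ` {1..m})) \<alpha> \<partial>M) < \<infinity>"
    using neg_moment[OF \<alpha>(1)] by auto
  then obtain E where E: "E \<ge> 0"
    "(\<integral>\<^sup>+\<omega>. ext_powr (Max ((\<lambda>l. \<bar>X (real l) \<omega> - X (real l - 1) \<omega>\<bar>) ` {1..m})) \<alpha> \<partial>M) = ennreal E"
    by (auto simp: less_top_ennreal)
  \<comment> \<open>The factor \<open>(T / m) powr (H * \<alpha>)\<close> of the block moment equals
    \<open>c powr \<alpha>\<close> and cancels against \<open>c powr - \<alpha>\<close>.\<close>
  define c where "c = (T / real m) powr H"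
  have "c > 0" using m \<open>T > 0\<close> by (simp add: c_def)
  define a where "a n = c * (2 powr - \<gamma>) ^ n" for n :: nat
  have "a n > 0" for n using \<open>c > 0\<close> by (simp add: a_def)
  \<comment> \<open>\<open>S n \<omega> < 1\<close> bounds every summand at once, and
    \<open>ext_powr_bound\<close> turns each into a lower bound \<open>a n\<close> for its block
    maximum.\<close>
  define S where "S n \<omega> = ennreal (a n powr - \<alpha>) *
    (\<Sum>k<(2::nat) ^ n. ext_powr (block_max T m (\<lambda>t. X t \<omega>) n k) \<alpha>)" for n \<omega>
  have [measurable]: "(\<lambda>\<omega>. block_max T m (\<lambda>t. X t \<omega>) n k) \<in> borel_measurable M" for n k
    by (rule block_max_measurable[OF meas \<open>T > 0\<close>])
  have "(\<integral>\<^sup>+\<omega>. S n \<omega> \<partial>M) = ennreal (E * (1 / 2) ^ n)" for n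
  proof -
    let ?h = "T / (real m * 2 ^ n)"
    have moment: "(\<integral>\<^sup>+\<omega>. ext_powr (block_max T m (\<lambda>t. X t \<omega>) n k) \<alpha> \<partial>M) =
        ennreal (?h powr (H * \<alpha>) * E)" for k
      using sssi_block_moment[OF sssi meas m \<open>T > 0\<close>, of n k \<alpha>] E(1) unfolding E(2)
      by (simp add: ennreal_mult)
    have "(\<integral>\<^sup>+\<omega>. S n \<omega> \<partial>M) = ennreal (a n powr - \<alpha> * (2 ^ n * (?h powr (H * \<alpha>) * E)))"
      using E(1) by (simp add: S_def nn_integral_cmult nn_integral_sum ennreal_mult moment
          flip: ennreal_power)
    also have "a n powr - \<alpha> = c powr - \<alpha> * 2 powr (real n * (\<gamma> * \<alpha>))"
      using \<open>c > 0\<close> by (simp add: a_def powr_mult powr_powr mult_ac flip: powr_realpow)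
    also have "?h powr (H * \<alpha>) = c powr \<alpha> * 2 powr (- (real n * (H * \<alpha>)))"
    proof -
      have "?h = (T / real m) * 2 powr (- real n)"
        by (simp add: powr_minus_divide powr_realpow)
      then show ?thesis
        using m \<open>T > 0\<close> by (simp only: powr_mult) (simp add: c_def powr_powr)
    qed
    also have "c powr - \<alpha> * 2 powr (real n * (\<gamma> * \<alpha>)) *
        (2 ^ n * (c powr \<alpha> * 2 powr (- (real n * (H * \<alpha>))) * E)) =
        (c powr - \<alpha> * c powr \<alpha>) *
        (2 powr (real n * (\<gamma> * \<alpha>)) * 2 powr real n * 2 powr (- (real n * (H * \<alpha>)))) * E"
      by (simp add: powr_realpow mult_ac)
    also have "c powr - \<alpha> * c powr \<alpha> = 1"
      using \<open>c > 0\<close> by (simp flip: powr_add)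
    also have "2 powr (real n * (\<gamma> * \<alpha>)) * 2 powr real n * 2 powr (- (real n * (H * \<alpha>))) =
        (2::real) powr (real n * (1 + \<alpha> * (\<gamma> - H)))"
      unfolding powr_add[symmetric] by (simp add: algebra_simps)
    also have "\<dots> = (1 / 2) ^ n"
      unfolding \<alpha> by (simp add: powr_minus_divide powr_realpow power_one_over)
    finally show ?thesis by (simp add: mult.commute)
  qed
  moreover have "(\<Sum>n. ennreal (E * (1 / 2) ^ n)) = ennreal (\<Sum>n. E * (1 / 2) ^ n)"
    using E(1) by (intro suminf_ennreal2 summable_mult[OF summable_geometric]) auto
  ultimately have "(\<Sum>n. \<integral>\<^sup>+\<omega>. S n \<omega> \<partial>M) < \<infinity>" by simp
  then have "AE \<omega> in M. \<forall>\<^sub>F n in sequentially. S n \<omega> < 1"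
    by (intro AE_eventually_less_one) (auto simp: S_def)
  then have "AE \<omega> in M. \<forall>\<^sub>F n in sequentially. \<forall>k<2 ^ n.
    c * (2 powr - \<gamma>) ^ n \<le> block_max T m (\<lambda>t. X t \<omega>) n k"
  proof eventually_elim
    fix \<omega> assume "\<forall>\<^sub>F n in sequentially. S n \<omega> < 1"
    then show "\<forall>\<^sub>F n in sequentially. \<forall>k<2 ^ n.
      c * (2 powr - \<gamma>) ^ n \<le> block_max T m (\<lambda>t. X t \<omega>) n k"
    proof eventually_elim
      case (elim n)
      show ?case
      proof (intro allI impI)
        fix k :: nat assume "k < 2 ^ n"
        then have "ext_powr (block_max T m (\<lambda>t. X t \<omega>) n k) \<alpha>
            \<le> (\<Sum>k<(2::nat) ^ n. ext_powr (block_max T m (\<lambda>t. X t \<omega>) n k) \<alpha>)"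
          by (intro member_le_sum) auto
        then have "ennreal (a n powr - \<alpha>) * ext_powr (block_max T m (\<lambda>t. X t \<omega>) n k) \<alpha> < 1"
          using elim unfolding S_def by (meson mult_left_mono le_less_trans zero_le)
        moreover have "block_max T m (\<lambda>t. X t \<omega>) n k \<ge> 0"
          unfolding block_max_def using m by (subst Max_ge_iff) auto
        ultimately show "c * (2 powr - \<gamma>) ^ n \<le> block_max T m (\<lambda>t. X t \<omega>) n k"
          using ext_powr_bound[OF \<open>a n > 0\<close> _ \<alpha>(1)] unfolding a_def by blast
      qed
    qed
  qed
  with m \<open>c > 0\<close> show ?thesis by blast
qed

section \<open>From block oscillations to pointwise exponents and the spectrum\<close>

text \<open>Blocks are closed, so the right end \<open>T\<close>, whose index is
  \<open>2 ^ n\<close>, is covered by the last one.\<close>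

lemma dyadic_block_covers:
  assumes "T > 0" "t \<in> {0..T}"
  obtains k where "k < 2 ^ n" "t \<in> {T * real k / 2 ^ n .. T * real k / 2 ^ n + T / 2 ^ n}"
proof (cases "dyadic_index T n t < 2 ^ n")
  case True
  then show thesis
    using that[of "dyadic_index T n t"] dyadic_floor_bounds[of T t n] assms
    by (simp add: dyadic_floor_def)
next
  case False
  have "t = T"
  proof -
    have "T \<le> dyadic_floor T n t"
      unfolding dyadic_floor_def using False \<open>T > 0\<close>
      by (simp add: pos_le_divide_eq)
    then show ?thesis using dyadic_floor_bounds(2)[of T t n] assms by auto
  qed
  have "T * real (2 ^ n - 1) / 2 ^ n + T / 2 ^ n = T"
    by (simp add: of_nat_diff right_diff_distrib diff_divide_distrib)
  moreover have "T / 2 ^ n \<ge> 0" using \<open>T > 0\<close> by simp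
  ultimately show thesis
    using \<open>t = T\<close> by (intro that[of "2 ^ n - 1"]) auto
qed

text \<open>All steps of a block containing \<open>t0\<close> have both ends within
  \<open>T / 2 ^ n\<close> of \<open>t0\<close>, so the exponent \<gamma>' would bound the block
  maximum by \<open>2 * C * (T / 2 ^ n) powr \<gamma>'\<close>, eventually below the assumed bound.
  This is deterministic and the assumption covers all \<open>k\<close>, so no point is
  excepted.\<close>

lemma block_max_lower_bound_not_Holder_at:
  assumes "T > 0" "m \<ge> 1" "c > 0" "0 \<le> \<gamma>" "\<gamma> < \<gamma>'"
    and lower: "\<forall>\<^sub>F n in sequentially. \<forall>k<2 ^ n. c * (2 powr - \<gamma>) ^ n \<le> block_max T m f n k"
    and t0: "t0 \<in> {0..T}"
  shows "\<not> Holder_at {0..T} t0 \<gamma>' f"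
proof
  assume "Holder_at {0..T} t0 \<gamma>' f"
  then obtain C d where "C > 0" "d > 0" and
    *: "\<And>t. t \<in> {0..T} \<Longrightarrow> t \<noteq> t0 \<Longrightarrow> dist t t0 < d \<Longrightarrow> \<bar>f t - f t0\<bar> \<le> C * \<bar>t - t0\<bar> powr \<gamma>'"
    unfolding Holder_at_def eventually_at by auto
  \<comment> \<open>The punctured neighbourhood says nothing at \<open>t0\<close>, where the bound
    is trivial. Passing from \<open>\<bar>t - t0\<bar>\<close> to \<open>e\<close> gives one bound
    for the whole block.\<close>
  have near: "\<bar>f t - f t0\<bar> \<le> C * e powr \<gamma>'" if "t \<in> {0..T}" "\<bar>t - t0\<bar> \<le> e" "e < d" for t e
  proof (cases "t = t0")
    case False
    then have "\<bar>f t - f t0\<bar> \<le> C * \<bar>t - t0\<bar> powr \<gamma>'"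
      using * that by (auto simp: dist_real_def)
    also have "\<dots> \<le> C * e powr \<gamma>'"
      using that \<open>C > 0\<close> assms by (intro mult_left_mono powr_mono2) auto
    finally show ?thesis .
  qed (use \<open>C > 0\<close> in simp)
  have "(\<lambda>n. T * (1 / 2) ^ n) \<longlonglongrightarrow> T * 0"
    by (intro tendsto_mult tendsto_const LIMSEQ_power_zero) auto
  then have ev1: "\<forall>\<^sub>F n in sequentially. T / 2 ^ n < d"
    using order_tendstoD(2)[of _ 0 sequentially d] \<open>d > 0\<close> by (simp add: power_one_over)
  have "\<bar>2 powr (\<gamma> - \<gamma>') :: real\<bar> < 1"
    using \<open>\<gamma> < \<gamma>'\<close> powr_less_mono[of "\<gamma> - \<gamma>'" 0 "2::real"] by simp
  then have "(\<lambda>n. 2 * C * T powr \<gamma>' * (2 powr (\<gamma> - \<gamma>')) ^ n) \<longlonglongrightarrow> 2 * C * T powr \<gamma>' * 0"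
    by (intro tendsto_mult tendsto_const LIMSEQ_power_zero) auto
  then have ev2: "\<forall>\<^sub>F n in sequentially. 2 * C * T powr \<gamma>' * (2 powr (\<gamma> - \<gamma>')) ^ n < c"
    using order_tendstoD(2)[of _ 0 sequentially c] \<open>c > 0\<close> by simp
  have "\<forall>\<^sub>F n in sequentially. False"
    using lower ev1 ev2
  proof eventually_elim
    case (elim n)
    obtain k where k: "k < 2 ^ n" "t0 \<in> {T * real k / 2 ^ n .. T * real k / 2 ^ n + T / 2 ^ n}"
      using dyadic_block_covers[OF \<open>T > 0\<close> t0] by blast
    have "block_max T m f n k \<le> 2 * C * (T / 2 ^ n) powr \<gamma>'"
      unfolding block_max_def
    proof (rule Max.boundedI)
      fix y assume "y \<in> (\<lambda>l. \<bar>f (T * real k / 2 ^ n + T / (real m * 2 ^ n) * real l)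
              - f (T * real k / 2 ^ n + T / (real m * 2 ^ n) * (real l - 1))\<bar>) ` {1..m}"
      then obtain l where l: "1 \<le> l" "l \<le> m" and
        y: "y = \<bar>f (T * real k / 2 ^ n + T / (real m * 2 ^ n) * real l)
              - f (T * real k / 2 ^ n + T / (real m * 2 ^ n) * (real l - 1))\<bar>" by auto
      have point: "\<bar>f (T * real k / 2 ^ n + T / (real m * 2 ^ n) * x) - f t0\<bar> \<le> C * (T / 2 ^ n) powr \<gamma>'"
        if x: "0 \<le> x" "x \<le> real m" for x
      proof (rule near)
        let ?p = "T / (real m * 2 ^ n) * x"
        have "?p \<le> T / (real m * 2 ^ n) * real m"
          using x \<open>T > 0\<close> by (intro mult_left_mono) auto
        also have "\<dots> = T / 2 ^ n" using \<open>m \<ge> 1\<close> by simp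
        finally have p: "0 \<le> ?p" "?p \<le> T / 2 ^ n" using x \<open>T > 0\<close> by auto
        then show "\<bar>T * real k / 2 ^ n + ?p - t0\<bar> \<le> T / 2 ^ n"
          using k(2) unfolding atLeastAtMost_iff by linarith
        have "T * real k / 2 ^ n + T / 2 ^ n = T * real (Suc k) / 2 ^ n"
          by (simp add: distrib_left add_divide_distrib)
        also have "\<dots> \<le> T * 2 ^ n / 2 ^ n"
        proof (intro divide_right_mono mult_left_mono)
          show "real (Suc k) \<le> 2 ^ n"
            using k(1) by (metis Suc_leI of_nat_le_iff of_nat_numeral of_nat_power)
        qed (use \<open>T > 0\<close> in auto)
        finally have "T * real k / 2 ^ n + T / 2 ^ n \<le> T" by simp
        moreover have "T * real k / 2 ^ n \<ge> 0" using \<open>T > 0\<close> by simp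
        ultimately show "T * real k / 2 ^ n + ?p \<in> {0..T}"
          using p unfolding atLeastAtMost_iff by linarith
      qed (rule elim)
      show "y \<le> 2 * C * (T / 2 ^ n) powr \<gamma>'"
        using point[of "real l"] point[of "real l - 1"] l unfolding y by simp
    qed (use \<open>m \<ge> 1\<close> in auto)
    \<comment> \<open>Splitting off \<open>(2 powr - \<gamma>) ^ n\<close> leaves
      \<open>(2 powr (\<gamma> - \<gamma>')) ^ n\<close>, which tends to 0.\<close>
    also have "(T / 2 ^ n) powr \<gamma>' = T powr \<gamma>' * (2 powr (\<gamma> - \<gamma>')) ^ n * (2 powr - \<gamma>) ^ n"
    proof -
      have "(2 powr (\<gamma> - \<gamma>')) ^ n * (2 powr - \<gamma>) ^ n = (2 powr - \<gamma>' :: real) ^ n"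
        by (simp flip: power_mult_distrib powr_add)
      also have "\<dots> = (2 powr (- real n)) powr \<gamma>'"
        by (simp add: powr_powr mult.commute flip: powr_realpow)
      also have "T powr \<gamma>' * \<dots> = (T * 2 powr (- real n)) powr \<gamma>'"
        by (simp add: powr_mult)
      also have "T * 2 powr (- real n) = T / 2 ^ n"
        by (simp add: powr_minus_divide powr_realpow)
      finally show ?thesis by (simp add: mult.assoc)
    qed
    also have "2 * C * (T powr \<gamma>' * (2 powr (\<gamma> - \<gamma>')) ^ n * (2 powr - \<gamma>) ^ n) =
        (2 * C * T powr \<gamma>' * (2 powr (\<gamma> - \<gamma>')) ^ n) * (2 powr - \<gamma>) ^ n" by simp
    also have "\<dots> < c * (2 powr - \<gamma>) ^ n"
      using elim(3) by (intro mult_strict_right_mono) auto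
    finally show False using elim(1) k(1) by fastforce
  qed
  then show False by simp
qed

text \<open>The supremum is determined by the exponents strictly below and strictly above
  \<open>H\<close>; membership at \<open>H\<close> itself is left open.\<close>

lemma Holder_exponent_eqI:
  assumes "\<And>\<gamma>. 0 < \<gamma> \<Longrightarrow> \<gamma> < H \<Longrightarrow> Holder_at D t0 \<gamma> f"
    and "\<And>\<gamma>. \<gamma> > H \<Longrightarrow> \<not> Holder_at D t0 \<gamma> f" and "H > 0"
  shows "Holder_exponent D f t0 = ennreal H"
proof (rule antisym)
  show "Holder_exponent D f t0 \<le> ennreal H"
    unfolding Holder_exponent_def
  proof (rule Sup_least)
    fix x assume "x \<in> {ennreal \<gamma> |\<gamma>. \<gamma> \<ge> 0 \<and> Holder_at D t0 \<gamma> f}"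
    then obtain \<gamma> where "x = ennreal \<gamma>" "Holder_at D t0 \<gamma> f" by blast
    with assms(2)[of \<gamma>] show "x \<le> ennreal H" by (cases "\<gamma> > H") (auto intro: ennreal_leI)
  qed
  show "ennreal H \<le> Holder_exponent D f t0"
  proof (rule ccontr)
    assume "\<not> ennreal H \<le> Holder_exponent D f t0"
    then have less: "Holder_exponent D f t0 < ennreal H" by simp
    then obtain r where r: "r \<ge> 0" "Holder_exponent D f t0 = ennreal r"
      by (cases "Holder_exponent D f t0") auto
    with less have "r < H" by (simp add: ennreal_less_iff)
    \<comment> \<open>The midpoint would be an admissible exponent larger than the supremum
      \<open>r\<close>.\<close>
    then have "ennreal ((r + H) / 2) \<le> Holder_exponent D f t0"
      unfolding Holder_exponent_def using assms(1)[of "(r + H) / 2"] r(1) \<open>H > 0\<close>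
      by (intro Sup_upper CollectI exI[of _ "(r + H) / 2"]) simp
    then show False using r \<open>r < H\<close> by (simp add: ennreal_le_iff2)
  qed
qed

lemma locally_Holder_on_imp_Holder_at:
  assumes "locally_Holder_on D \<gamma> f" "t0 \<in> D"
  shows "Holder_at D t0 \<gamma> f"
proof -
  obtain U C where U: "open U" "t0 \<in> U" "C > 0"
    "\<forall>s\<in>U \<inter> D. \<forall>t\<in>U \<inter> D. \<bar>f s - f t\<bar> \<le> C * \<bar>s - t\<bar> powr \<gamma>"
    using assms unfolding locally_Holder_on_def by meson
  have "\<forall>\<^sub>F t in at t0 within D. t \<in> U \<inter> D"
    using U unfolding eventually_at_topological by auto
  then have "\<forall>\<^sub>F t in at t0 within D. \<bar>f t - f t0\<bar> \<le> C * \<bar>t - t0\<bar> powr \<gamma>"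
    by eventually_elim (use U assms(2) in auto)
  then show ?thesis using U(3) unfolding Holder_at_def by blast
qed

lemma trivial_spectrum_onI:
  assumes "\<And>t. t \<in> {0..T} \<Longrightarrow> Holder_exponent {0..T} f t = ennreal H"
  shows "trivial_spectrum_on H T f"
  unfolding trivial_spectrum_on_def spectrum_on_def Hausdorff_dim_def
proof (intro allI impI if_P)
  fix h assume "h \<noteq> ennreal H"
  then show "{t \<in> {0..T}. Holder_exponent {0..T} f t = h} = {}" using assms by blast
qed

text \<open>The lower bound is known for \<open>X\<close>, the path regularity for \<open>Y\<close>.
  The two agree almost surely at all grid points in \<open>{0..T}\<close>, which are countably many,
  and block maxima see nothing else.\<close>

lemma sssi_modification_trivial_spectrum:
  assumes sssi: "sssi M H X" and meas: "\<And>t. t \<ge> 0 \<Longrightarrow> X t \<in> borel_measurable M"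
    and "H > 0" "T > 0" and Y: "Holder_modification M H T X Y"
    and neg_moment: "\<And>\<alpha>. \<alpha> < 0 \<Longrightarrow> \<exists>m::nat. m \<ge> 1 \<and>
      (\<integral>\<^sup>+\<omega>. ext_powr (Max ((\<lambda>l. \<bar>X (real l) \<omega> - X (real l - 1) \<omega>\<bar>) ` {1..m})) \<alpha> \<partial>M) < \<infinity>"
  shows "AE \<omega> in M. trivial_spectrum_on H T (\<lambda>t. Y t \<omega>)"
proof -
  let ?p = "\<lambda>n k m l. T * real k / 2 ^ n + T / (real m * 2 ^ n) * real l"
  have "AE \<omega> in M. \<forall>n k m l. ?p n k m l \<in> {0..T} \<longrightarrow> Y (?p n k m l) \<omega> = X (?p n k m l) \<omega>"
    using Y unfolding Holder_modification_def modification_on_def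
    by (intro AE_all_countable[THEN iffD2] allI AE_impI) auto
  \<comment> \<open>Rational exponents above \<open>H\<close> again give a single null set;
    \<open>m\<close> and \<open>c\<close> may vary with \<open>p\<close>.\<close>
  moreover have "AE \<omega> in M. \<forall>p::rat. H < of_rat p \<longrightarrow> (\<exists>m\<ge>1. \<exists>c>0. \<forall>\<^sub>F n in sequentially. \<forall>k<2 ^ n.
    c * (2 powr - of_rat p) ^ n \<le> block_max T m (\<lambda>t. X t \<omega>) n k)"
  proof (intro AE_all_countable[THEN iffD2] allI AE_impI)
    fix p :: rat assume "H < of_rat p"
    from sssi_block_max_lower_bound[OF sssi meas this \<open>T > 0\<close> neg_moment]
    obtain m c where "m \<ge> 1" "c > 0" and "AE \<omega> in M. \<forall>\<^sub>F n in sequentially. \<forall>k<2 ^ n.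
      c * (2 powr - of_rat p) ^ n \<le> block_max T m (\<lambda>t. X t \<omega>) n k" by auto
    from this(3) show "AE \<omega> in M. \<exists>m\<ge>1. \<exists>c>0. \<forall>\<^sub>F n in sequentially. \<forall>k<2 ^ n.
      c * (2 powr - of_rat p) ^ n \<le> block_max T m (\<lambda>t. X t \<omega>) n k"
      by eventually_elim (use \<open>m \<ge> 1\<close> \<open>c > 0\<close> in blast)
  qed
  moreover have "AE \<omega> in M. \<forall>\<gamma>\<in>{0<..<H}. locally_Holder_on {0..T} \<gamma> (\<lambda>t. Y t \<omega>)"
    using Y by (simp add: Holder_modification_def)
  ultimately show ?thesis
  proof eventually_elim
    case (elim \<omega>)
    have grid: "block_max T m (\<lambda>t. Y t \<omega>) n k = block_max T m (\<lambda>t. X t \<omega>) n k"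
      if "m \<ge> 1" "k < 2 ^ n" for m n k
    proof -
      have eq: "Y (?p n k m l) \<omega> = X (?p n k m l) \<omega>" if l: "l \<le> m" for l
      proof -
        have "?p n k m l \<le> T * real k / 2 ^ n + T / (real m * 2 ^ n) * real m"
          using l \<open>T > 0\<close> by (intro add_left_mono mult_left_mono) auto
        also have "\<dots> = T * real (Suc k) / 2 ^ n"
          using \<open>m \<ge> 1\<close> by (simp add: distrib_left add_divide_distrib)
        also have "\<dots> \<le> T * 2 ^ n / 2 ^ n"
        proof (intro divide_right_mono mult_left_mono)
          show "real (Suc k) \<le> 2 ^ n"
            using \<open>k < 2 ^ n\<close> by (metis Suc_leI of_nat_le_iff of_nat_numeral of_nat_power)
        qed (use \<open>T > 0\<close> in auto)
        finally have "?p n k m l \<le> T" by simp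
        moreover have "?p n k m l \<ge> 0" using \<open>T > 0\<close> by simp
        ultimately show ?thesis using elim(1) by simp
      qed
      have "Y (?p n k m l) \<omega> = X (?p n k m l) \<omega> \<and>
          Y (T * real k / 2 ^ n + T / (real m * 2 ^ n) * (real l - 1)) \<omega> =
          X (T * real k / 2 ^ n + T / (real m * 2 ^ n) * (real l - 1)) \<omega>" if l: "l \<in> {1..m}" for l
      proof -
        \<comment> \<open>Since \<open>l \<ge> 1\<close>, \<open>real l - 1\<close> is the index of
          a preceding grid point.\<close>
        obtain j where "l = Suc j" using l by (cases l) auto
        then show ?thesis using eq[of l] eq[of j] l by simp
      qed
      then show ?thesis
        unfolding block_max_def by (intro arg_cong[where f = Max] image_cong) auto
    qed
    show ?case
    proof (rule trivial_spectrum_onI, rule Holder_exponent_eqI)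
      fix t0 \<gamma> assume t0: "t0 \<in> {0..T}"
      show "Holder_at {0..T} t0 \<gamma> (\<lambda>t. Y t \<omega>)" if "0 < \<gamma>" "\<gamma> < H"
        using elim(3) t0 that by (intro locally_Holder_on_imp_Holder_at) auto
      show "\<not> Holder_at {0..T} t0 \<gamma> (\<lambda>t. Y t \<omega>)" if \<gamma>: "\<gamma> > H"
      proof -
        obtain p :: rat where p: "H < of_rat p" "of_rat p < \<gamma>"
          using of_rat_dense[OF \<gamma>] by auto
        from elim(2)[rule_format, OF p(1)] obtain m c where mc: "m \<ge> 1" "c > 0" "\<forall>\<^sub>F n in sequentially. \<forall>k<2 ^ n.
          c * (2 powr - of_rat p) ^ n \<le> block_max T m (\<lambda>t. X t \<omega>) n k"
          by auto
        from mc(3) have "\<forall>\<^sub>F n in sequentially. \<forall>k<2 ^ n.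
          c * (2 powr - of_rat p) ^ n \<le> block_max T m (\<lambda>t. Y t \<omega>) n k"
          by eventually_elim (use grid mc(1) in simp)
        moreover have "0 \<le> (of_rat p :: real)" using p(1) \<open>H > 0\<close> by linarith
        ultimately show ?thesis
          by (intro block_max_lower_bound_not_Holder_at[OF \<open>T > 0\<close> mc(1,2) _ p(2) _ t0]) auto
      qed
    qed (rule \<open>H > 0\<close>)
  qed
qed

section \<open>The degenerate case \<open>H = 0\<close>, and the theorem\<close>

text \<open>For \<open>H = 0\<close> the law of \<open>X h\<close> is the same for all
  \<open>h > 0\<close>, and stochastic continuity concentrates it at 0. Stationarity passes this on
  to all increments.\<close>

lemma zero_sssi_increments:
  assumes "prob_space M" and sssi: "sssi M 0 X"
    and meas: "\<And>t. t \<ge> 0 \<Longrightarrow> X t \<in> borel_measurable M"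
    and cont: "stoch_continuous_at_zero M X" and "0 \<le> s" "s < t"
  shows "AE \<omega> in M. X t \<omega> = X s \<omega>"
proof -
  interpret prob_space M by fact
  have law: "(\<integral>\<^sup>+\<omega>. g (X h \<omega>) \<partial>M) = (\<integral>\<^sup>+\<omega>. g (X 1 \<omega>) \<partial>M)"
    if "h > 0" and g: "g \<in> borel_measurable borel" for h and g :: "real \<Rightarrow> ennreal"
  proof -
    have "same_fdd M (\<lambda>t. X (h * t)) (\<lambda>t \<omega>. X t \<omega>)"
      using sssi \<open>h > 0\<close> by (auto simp: sssi_def self_similar_def)
    moreover have "(\<lambda>x. g (x 1)) \<in> borel_measurable (\<Pi>\<^sub>M t\<in>{1::real}. borel)"
      by (rule measurable_compose[OF _ g], rule measurable_component_singleton) simp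
    ultimately show ?thesis
      using same_fdd_nn_integral[of M "\<lambda>t. X (h * t)" X "{1}" "\<lambda>x. g (x 1)"] \<open>h > 0\<close> meas by simp
  qed
  have "AE \<omega> in M. \<not> \<bar>X 1 \<omega>\<bar> > \<epsilon>" if "\<epsilon> > 0" for \<epsilon>
  proof -
    have tail: "emeasure M {\<omega>\<in>space M. \<bar>X h \<omega>\<bar> > \<epsilon>} = emeasure M {\<omega>\<in>space M. \<bar>X 1 \<omega>\<bar> > \<epsilon>}" if "h > 0" for h
    proof -
      have "emeasure M {\<omega>\<in>space M. \<bar>X u \<omega>\<bar> > \<epsilon>} = (\<integral>\<^sup>+\<omega>. indicator {x. \<bar>x\<bar> > \<epsilon>} (X u \<omega>) \<partial>M)"
        if "u > 0" for u
      proof -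
        have [measurable]: "X u \<in> borel_measurable M" using meas that by simp
        have "{\<omega>\<in>space M. \<bar>X u \<omega>\<bar> > \<epsilon>} \<in> sets M" by measurable
        then have "emeasure M {\<omega>\<in>space M. \<bar>X u \<omega>\<bar> > \<epsilon>} =
            (\<integral>\<^sup>+\<omega>. indicator {\<omega>\<in>space M. \<bar>X u \<omega>\<bar> > \<epsilon>} \<omega> \<partial>M)" by simp
        also have "\<dots> = (\<integral>\<^sup>+\<omega>. indicator {x. \<bar>x\<bar> > \<epsilon>} (X u \<omega>) \<partial>M)"
          by (intro nn_integral_cong) (auto simp: indicator_def)
        finally show ?thesis .
      qed
      moreover have "(indicator {x::real. \<bar>x\<bar> > \<epsilon>} :: real \<Rightarrow> ennreal) \<in> borel_measurable borel"
        by measurable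
      note law[OF \<open>h > 0\<close> this]
      ultimately show ?thesis using \<open>h > 0\<close> by simp
    qed
    have "((\<lambda>h. measure M {\<omega>\<in>space M. \<bar>X h \<omega>\<bar> > \<epsilon>}) \<longlongrightarrow> 0) (at_right 0)"
      using cont \<open>\<epsilon> > 0\<close> by (simp add: stoch_continuous_at_zero_def)
    moreover have "\<forall>\<^sub>F h in at_right 0.
        measure M {\<omega>\<in>space M. \<bar>X h \<omega>\<bar> > \<epsilon>} = measure M {\<omega>\<in>space M. \<bar>X 1 \<omega>\<bar> > \<epsilon>}"
      using eventually_at_right_less[of "0::real"]
    proof eventually_elim
      case (elim h)
      show ?case unfolding measure_def tail[OF elim] ..
    qed
    ultimately have "((\<lambda>h::real. measure M {\<omega>\<in>space M. \<bar>X 1 \<omega>\<bar> > \<epsilon>}) \<longlongrightarrow> 0) (at_right 0)"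
      by (rule Lim_transform_eventually)
    then have "measure M {\<omega>\<in>space M. \<bar>X 1 \<omega>\<bar> > \<epsilon>} = 0"
      by (simp add: tendsto_const_iff)
    moreover have [measurable]: "X 1 \<in> borel_measurable M" using meas by simp
    have "{\<omega>\<in>space M. \<bar>X 1 \<omega>\<bar> > \<epsilon>} \<in> sets M" by measurable
    ultimately show ?thesis
      by (intro AE_I[of _ _ "{\<omega>\<in>space M. \<bar>X 1 \<omega>\<bar> > \<epsilon>}"]) (auto simp: emeasure_eq_measure)
  qed
  then have "AE \<omega> in M. \<forall>i::nat. \<not> \<bar>X 1 \<omega>\<bar> > 1 / real (Suc i)"
    by (intro AE_all_countable[THEN iffD2]) auto
  then have "AE \<omega> in M. X 1 \<omega> = 0"
  proof eventually_elim
    case (elim \<omega>)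
    then show ?case using nat_approx_posE[of "\<bar>X 1 \<omega>\<bar>"] by (metis zero_less_abs_iff)
  qed
  have meas_abs: "(\<lambda>\<omega>. ennreal \<bar>X u \<omega>\<bar>) \<in> borel_measurable M" if "u \<ge> 0" for u
    using meas[OF that] by simp
  have zero: "AE \<omega> in M. X u \<omega> = 0" if "u > 0" for u
  proof -
    have "(\<integral>\<^sup>+\<omega>. ennreal \<bar>X u \<omega>\<bar> \<partial>M) = (\<integral>\<^sup>+\<omega>. ennreal \<bar>X 1 \<omega>\<bar> \<partial>M)"
      using law[OF that, of "\<lambda>x. ennreal \<bar>x\<bar>"] by simp
    also have "\<dots> = 0"
      using \<open>AE \<omega> in M. X 1 \<omega> = 0\<close> meas_abs by (subst nn_integral_0_iff_AE) auto
    finally show ?thesis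
      using meas_abs that by (subst (asm) nn_integral_0_iff_AE) auto
  qed
  have incr: "(\<integral>\<^sup>+\<omega>. ennreal (\<bar>X v \<omega> - X u \<omega>\<bar> powr 1) \<partial>M) = (\<integral>\<^sup>+\<omega>. ennreal (\<bar>X 1 \<omega> - X 0 \<omega>\<bar> powr 1) \<partial>M)"
    if "0 \<le> u" "u < v" for u v
    using sssi_increment_moment[OF sssi meas that, of 1] that by simp
  \<comment> \<open>Scaling yields nothing about \<open>X 0\<close>, so the increment from 1 to 2 is
    shown to vanish first; stationarity carries this to every pair of times, including
    \<open>s = 0\<close>.\<close>
  have "(\<integral>\<^sup>+\<omega>. ennreal (\<bar>X 2 \<omega> - X 1 \<omega>\<bar> powr 1) \<partial>M) = (\<integral>\<^sup>+\<omega>. 0 \<partial>M)"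
    using zero[of 1] zero[of 2] by (intro nn_integral_cong_AE) auto
  then have "(\<integral>\<^sup>+\<omega>. ennreal (\<bar>X t \<omega> - X s \<omega>\<bar> powr 1) \<partial>M) = 0"
    using incr[of 1 2] incr[OF \<open>0 \<le> s\<close> \<open>s < t\<close>] by simp
  moreover have "(\<lambda>\<omega>. ennreal (\<bar>X t \<omega> - X s \<omega>\<bar> powr 1)) \<in> borel_measurable M"
    using meas[of s] meas[of t] \<open>0 \<le> s\<close> \<open>s < t\<close> by simp
  ultimately show ?thesis
    by (subst (asm) nn_integral_0_iff_AE) auto
qed

theorem corollary2:
  fixes M :: "'a measure" and X :: "real \<Rightarrow> 'a \<Rightarrow> real" and H :: real
  assumes "prob_space M"
    and "measurable_process M X"
    and "separable_process M X"
    and "\<not> as_constant M X"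
    and "stoch_continuous_at_zero M X"
    and "sssi M H X"
    and "\<And>q t. q > 0 \<Longrightarrow> t \<ge> 0 \<Longrightarrow> integrable M (\<lambda>\<omega>. \<bar>X t \<omega>\<bar> powr q)"
    and "\<And>\<alpha>. \<alpha> < 0 \<Longrightarrow> \<exists>m0::nat. m0 \<ge> 1 \<and>
           (\<integral>\<^sup>+\<omega>. ext_powr (Max ((\<lambda>l. \<bar>X (real l) \<omega> - X (real l - 1) \<omega>\<bar>) ` {1..m0})) \<alpha> \<partial>M) < \<infinity>"
  shows "\<forall>T>0. (\<exists>Y. Holder_modification M H T X Y) \<and>
           (\<forall>Y. Holder_modification M H T X Y \<longrightarrow>
              (AE \<omega> in M. trivial_spectrum_on H T (\<lambda>t. Y t \<omega>)))"
proof -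
  interpret prob_space M by fact
  note meas = process_borel_measurable[OF assms(2)]
  have "H > 0"
  proof (rule ccontr)
    assume "\<not> H > 0"
    then have "sssi M 0 X" using assms(6) by (auto simp: sssi_def)
    note const = zero_sssi_increments[OF assms(1) this meas assms(5)]
    obtain m :: nat where m: "m \<ge> 1" and
      fin: "(\<integral>\<^sup>+\<omega>. ext_powr (Max ((\<lambda>l. \<bar>X (real l) \<omega> - X (real l - 1) \<omega>\<bar>) ` {1..m})) (- 1) \<partial>M) < \<infinity>"
      using assms(8)[of "- 1"] by auto
    have "AE \<omega> in M. \<forall>j::nat. X (real (Suc j)) \<omega> = X (real j) \<omega>"
      using const by (intro AE_all_countable[THEN iffD2]) auto
    \<comment> \<open>All \<open>m\<close> steps vanish, so the maximum is 0 and its power of order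
      -1 is \<infinity> by convention; on a probability space the integral is then
      \<infinity>.\<close>
    then have "AE \<omega> in M. ext_powr (Max ((\<lambda>l. \<bar>X (real l) \<omega> - X (real l - 1) \<omega>\<bar>) ` {1..m})) (- 1) = \<infinity>"
    proof eventually_elim
      case (elim \<omega>)
      have "\<bar>X (real l) \<omega> - X (real l - 1) \<omega>\<bar> = 0" if l: "l \<in> {1..m}" for l
      proof -
        obtain j where "l = Suc j" using l by (cases l) auto
        then show ?thesis using elim[rule_format, of j] by simp
      qed
      then have "(\<lambda>l. \<bar>X (real l) \<omega> - X (real l - 1) \<omega>\<bar>) ` {1..m} = (\<lambda>l. 0) ` {1..m}"
        by (rule image_cong[OF refl])
      also have "\<dots> = {0}" using m by auto
      finally show ?case by (simp add: ext_powr_def)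
    qed
    then have "(\<integral>\<^sup>+\<omega>. ext_powr (Max ((\<lambda>l. \<bar>X (real l) \<omega> - X (real l - 1) \<omega>\<bar>) ` {1..m})) (- 1) \<partial>M) =
        (\<integral>\<^sup>+\<omega>. \<infinity> \<partial>M)" by (rule nn_integral_cong_AE)
    then show False using fin by (simp add: emeasure_space_1)
  qed
  then show ?thesis
    using sssi_Holder_modification_exists[OF assms(6) meas assms(7)]
      sssi_modification_trivial_spectrum[OF assms(6) meas _ _ _ assms(8)] by blast
qed

end
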